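(* Let $n\geq 1$, $\nu\geq 1$, let $0\leq q_1,q_2,q_3<n$, and let $P=P_n(x_0x_{q_1}x_{q_1+q_2}x_{q_1+q_2+q_3})$ (subscripts mod $n$) be irreducible and non-redundant, and let $G$ be the group defined by $P$. Then $P$ is $(2,4,\nu)$-special if and only if $n=8$, $\nu=2$, $q_1\in\{1,3,5,7\}$ and one of the following holds: (a) ($q_2\equiv 3q_1$ and $q_3\equiv 5q_1$ mod $n$) or ($q_2\equiv 7q_1$ and $q_3\equiv 5q_1$ mod $n$), in which case $G\cong G_8(x_0x_1x_4x_1)$, which contains a subgroup isomorphic to $F_2\times F_2$; (b) ($q_2\equiv 5q_1$ and $q_3\equiv 3q_1$ mod $n$) or ($q_2\equiv 7q_1$ and $q_3\equiv 3q_1$ mod $n$), in which case $G\cong G_8(x_0x_1x_6x_1)$; (c) ($q_2\equiv 3q_1$ and $q_3\equiv 7q_1$ mod $n$) or ($q_2\equiv 5q_1$ and $q_3\equiv 7q_1$ mod $n$), in which case $G\cong G_8(x_0x_1x_4x_3)$.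
   Context: Cyclic presentations: $F_n$ is the free group with basis $x_0,\ldots,x_{n-1}$ (so $F_2$ is the free group of rank $2$) and $\theta:F_n\to F_n$ is the automorphism $\theta(x_i)=x_{i+1}$ (subscripts mod $n$). For a cyclically reduced word $w\in F_n$, $P_n(w)=\langle x_0,\ldots,x_{n-1}\mid w,\theta(w),\ldots,\theta^{n-1}(w)\rangle$ and $G_n(w)$ is the group it defines. $P_n(w)$ is irreducible if the greatest common divisor of $n$ and the subscripts of the generators appearing in $w$ is $1$. Non-redundant: a relator $r\in R$ of $\langle X\mid R\rangle$ is freely redundant if it is freely trivial or there is $s\in R$ such that $r,s$ are distinct elements of the free group on $X$ and $r$ is freely conjugate to $s$ or to $s^{-1}$. A presentation is non-redundant if it contains no freely redundant relator. Star graph: let $\tilde R$ be the set of all cyclic permutations of elements of $R\cup R^{-1}$. The star graph of $\langle X\mid R\rangle$ (all relators cyclically reduced) is the undirected graph, possibly with multiple edges, with vertex set $X\cup X^{-1}$ and an edge joining $x$ and $y$ for each distinct word of the form $xy^{-1}u$ in $\tilde R$, where the edges corresponding to the inverse pair $xy^{-1}u$, $yx^{-1}u^{-1}$ are identified. Special presentations: let $m\geq 2$, $k\geq 3$, $\nu\geq 1$. A finite presentation $\langle X\mid R\rangle$ is $(m,k,\nu)$-special if (a) its star graph has exactly $\nu$ connected components, which are pairwise isomorphic, each a connected bipartite graph of diameter $m$ and girth $2m$ in which each vertex has degree at least $3$; (b) each relator has length $k$; (c) if $m=2$ then $k\geq 4$. Girth is the length of a shortest closed path in which consecutive edges are never equal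 (so a pair of parallel edges gives such a path of length $2$). *)

theory Defs
  imports "HOL-Algebra.Coset" "HOL-Number_Theory.Cong" "HOL-Library.Extended_Nat"
begin

section \<open>Words and free groups\<close>

text \<open>The letter \<open>(x, True)\<close> stands for the generator \<open>x\<close> and \<open>(x, False)\<close> for its formal inverse.\<close>

type_synonym 'a letter = "'a \<times> bool"
type_synonym 'a word = "'a letter list"

definition inv_letter :: "'a letter \<Rightarrow> 'a letter" where
  "inv_letter a = (fst a, \<not> snd a)"

definition inv_word :: "'a word \<Rightarrow> 'a word" where
  "inv_word w = rev (map inv_letter w)"

definition reduced_word :: "'a word \<Rightarrow> bool" where
  "reduced_word w \<longleftrightarrow> successively (\<lambda>a b. b \<noteq> inv_letter a) w"

definition cyclically_reduced_word :: "'a word \<Rightarrow> bool" where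
  "cyclically_reduced_word w \<longleftrightarrow>
     reduced_word w \<and> (w \<noteq> [] \<longrightarrow> hd w \<noteq> inv_letter (last w))"

fun cons_reduce :: "'a letter \<Rightarrow> 'a word \<Rightarrow> 'a word" where
  "cons_reduce a [] = [a]"
| "cons_reduce a (b # w) = (if b = inv_letter a then w else a # b # w)"

definition free_reduce :: "'a word \<Rightarrow> 'a word" where
  "free_reduce w = foldr cons_reduce w []"

definition free_group :: "'a set \<Rightarrow> 'a word monoid" where
  "free_group X = \<lparr> carrier = {w. reduced_word w \<and> fst ` set w \<subseteq> X},
                    monoid.mult = (\<lambda>u v. free_reduce (u @ v)),
                    one = [] \<rparr>"

lemma inv_letter_inv_letter [simp]: "inv_letter (inv_letter a) = a"
  by (simp add: inv_letter_def)

lemma fst_inv_letter [simp]: "fst (inv_letter a) = fst a"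
  by (simp add: inv_letter_def)

lemma reduced_word_simps [simp]:
  "reduced_word []" "reduced_word [a]"
  "reduced_word (a # b # w) \<longleftrightarrow> b \<noteq> inv_letter a \<and> reduced_word (b # w)"
  by (simp_all add: reduced_word_def)

lemma reduced_word_ConsD: "reduced_word (a # w) \<Longrightarrow> reduced_word w"
  by (cases w) auto

lemma reduced_cons_reduce: "reduced_word w \<Longrightarrow> reduced_word (cons_reduce a w)"
  by (cases w) (auto dest: reduced_word_ConsD)

lemma cons_reduce_reduced: "reduced_word (a # w) \<Longrightarrow> cons_reduce a w = a # w"
  by (cases w) auto

lemma cons_reduce_cancel:
  "reduced_word w \<Longrightarrow> cons_reduce a (cons_reduce (inv_letter a) w) = w"
  by (cases w) (auto simp: cons_reduce_reduced)

lemma reduced_foldr_cons_reduce: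
  "reduced_word v \<Longrightarrow> reduced_word (foldr cons_reduce u v)"
  by (induction u) (auto simp: reduced_cons_reduce)

lemma foldr_cons_reduce_cons_reduce:
  assumes "reduced_word v"
  shows "foldr cons_reduce (cons_reduce a u) v = cons_reduce a (foldr cons_reduce u v)"
  using cons_reduce_cancel[OF reduced_foldr_cons_reduce[OF assms]]
  by (cases u) auto

lemma foldr_free_reduce:
  "reduced_word v \<Longrightarrow> foldr cons_reduce (free_reduce u) v = foldr cons_reduce u v"
  by (induction u) (auto simp: free_reduce_def foldr_cons_reduce_cons_reduce)

lemma free_reduce_reduced: "reduced_word w \<Longrightarrow> free_reduce w = w"
proof (induction w)
  case (Cons a w)
  then have "free_reduce w = w"
    by (blast dest: reduced_word_ConsD)
  then show ?case
    using cons_reduce_reduced[OF Cons.prems] by (simp add: free_reduce_def)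
qed (simp add: free_reduce_def)

lemma reduced_free_reduce: "reduced_word (free_reduce w)"
  by (simp add: free_reduce_def reduced_foldr_cons_reduce)

lemma free_reduce_append:
  "free_reduce (u @ v) = foldr cons_reduce u (free_reduce v)"
  by (simp add: free_reduce_def)

lemma set_cons_reduce: "set (cons_reduce a w) \<subseteq> insert a (set w)"
  by (cases w) auto

lemma set_free_reduce: "set (free_reduce w) \<subseteq> set w"
proof (induction w)
  case Nil
  then show ?case by (simp add: free_reduce_def)
next
  case (Cons a w)
  then show ?case
    using set_cons_reduce[of a "free_reduce w"] by (auto simp: free_reduce_def)
qed

lemma reduced_word_append_single:
  "reduced_word (w @ [a]) \<longleftrightarrow> reduced_word w \<and> (w \<noteq> [] \<longrightarrow> a \<noteq> inv_letter (last w))"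
  by (auto simp: reduced_word_def successively_append_iff)

lemma reduced_inv_word: "reduced_word w \<Longrightarrow> reduced_word (inv_word w)"
proof (induction w)
  case (Cons a w)
  then have IH: "reduced_word (inv_word w)"
    by (blast dest: reduced_word_ConsD)
  show ?case
  proof (cases w)
    case (Cons b v)
    then show ?thesis
      using IH \<open>reduced_word (a # w)\<close> reduced_word_append_single[of "inv_word w" "inv_letter a"]
      by (auto simp: inv_word_def)
  qed (simp add: inv_word_def)
qed (simp add: inv_word_def)

lemma free_reduce_inv_word_append:
  "reduced_word v \<Longrightarrow> foldr cons_reduce (inv_word w) (foldr cons_reduce w v) = v"
proof (induction w arbitrary: v)
  case (Cons a w)
  have "cons_reduce (inv_letter a) (cons_reduce a (foldr cons_reduce w v)) = foldr cons_reduce w v"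
    using cons_reduce_cancel[of "foldr cons_reduce w v" "inv_letter a"]
      reduced_foldr_cons_reduce[OF Cons.prems] by simp
  then show ?case using Cons by (simp add: inv_word_def)
qed (simp add: inv_word_def)

lemma group_free_group: "group (free_group X)"
proof (rule groupI)
  fix u v assume uv: "u \<in> carrier (free_group X)" "v \<in> carrier (free_group X)"
  have "fst ` set (free_reduce (u @ v)) \<subseteq> X"
    using uv set_free_reduce[of "u @ v"] by (fastforce simp: free_group_def)
  then show "u \<otimes>\<^bsub>free_group X\<^esub> v \<in> carrier (free_group X)"
    by (simp add: free_group_def reduced_free_reduce)
next
  fix u v w
  show "u \<otimes>\<^bsub>free_group X\<^esub> v \<otimes>\<^bsub>free_group X\<^esub> w = u \<otimes>\<^bsub>free_group X\<^esub> (v \<otimes>\<^bsub>free_group X\<^esub> w)"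
    by (simp add: free_group_def free_reduce_append[of "free_reduce (u @ v)"]
        free_reduce_append[of u "free_reduce (v @ w)"] foldr_free_reduce
        free_reduce_reduced reduced_free_reduce)
       (simp add: free_reduce_append)
next
  fix u assume u: "u \<in> carrier (free_group X)"
  have "inv_word u \<in> carrier (free_group X)"
    using u reduced_inv_word[of u] by (fastforce simp: free_group_def inv_word_def)
  moreover have "inv_word u \<otimes>\<^bsub>free_group X\<^esub> u = \<one>\<^bsub>free_group X\<^esub>"
    using free_reduce_inv_word_append[of "[]" u]
    by (simp add: free_group_def free_reduce_def)
  ultimately show "\<exists>v\<in>carrier (free_group X). v \<otimes>\<^bsub>free_group X\<^esub> u = \<one>\<^bsub>free_group X\<^esub>"
    by blast
qed (auto simp: free_group_def free_reduce_reduced)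

section \<open>Presentations\<close>

record 'a presentation =
  gens :: "'a set"
  rels :: "'a word set"

definition normal_closure :: "('a, 'b) monoid_scheme \<Rightarrow> 'a set \<Rightarrow> 'a set" where
  "normal_closure G S = \<Inter> {N. N \<lhd> G \<and> S \<subseteq> N}"

definition presented_group :: "'a presentation \<Rightarrow> 'a word set monoid" where
  "presented_group P = free_group (gens P) Mod normal_closure (free_group (gens P)) (rels P)"

definition finite_cyclically_reduced_presentation :: "'a presentation \<Rightarrow> bool" where
  "finite_cyclically_reduced_presentation P \<longleftrightarrow>
     finite (gens P) \<and> finite (rels P) \<and>
     (\<forall>r\<in>rels P. cyclically_reduced_word r \<and> fst ` set r \<subseteq> gens P)"

definition freely_conjugate :: "'a set \<Rightarrow> 'a word \<Rightarrow> 'a word \<Rightarrow> bool" where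
  "freely_conjugate X r s \<longleftrightarrow>
     (\<exists>g\<in>carrier (free_group X).
        r = g \<otimes>\<^bsub>free_group X\<^esub> s \<otimes>\<^bsub>free_group X\<^esub> inv\<^bsub>free_group X\<^esub> g)"

text \<open>Relators are reduced words, that is, elements of the free group, so that equality of
  relators as words is equality in the free group.\<close>

definition freely_redundant :: "'a presentation \<Rightarrow> 'a word \<Rightarrow> bool" where
  "freely_redundant P r \<longleftrightarrow>
     r = \<one>\<^bsub>free_group (gens P)\<^esub> \<or>
     (\<exists>s\<in>rels P. r \<noteq> s \<and>
        (freely_conjugate (gens P) r s \<or>
         freely_conjugate (gens P) r (inv\<^bsub>free_group (gens P)\<^esub> s)))"

definition non_redundant :: "'a presentation \<Rightarrow> bool" where
  "non_redundant P \<longleftrightarrow> (\<forall>r\<in>rels P. \<not> freely_redundant P r)"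

section \<open>Cyclic presentations\<close>

definition shift :: "nat \<Rightarrow> nat word \<Rightarrow> nat word" where
  "shift n w = map (\<lambda>(i, e). ((i + 1) mod n, e)) w"

definition cyclic_presentation :: "nat \<Rightarrow> nat word \<Rightarrow> nat presentation" where
  "cyclic_presentation n w = \<lparr> gens = {..<n}, rels = {(shift n ^^ k) w | k. k < n} \<rparr>"

definition cyclically_presented_group :: "nat \<Rightarrow> nat word \<Rightarrow> nat word set monoid" where
  "cyclically_presented_group n w = presented_group (cyclic_presentation n w)"

text \<open>The positive word with the given subscripts, read modulo \<open>n\<close>.\<close>

definition positive_word :: "nat \<Rightarrow> nat list \<Rightarrow> nat word" where
  "positive_word n is = map (\<lambda>i. (i mod n, True)) is"

definition irreducible_cyclic :: "nat \<Rightarrow> nat word \<Rightarrow> bool" where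
  "irreducible_cyclic n w \<longleftrightarrow> Gcd (insert n (fst ` set w)) = 1"

section \<open>Undirected multigraphs\<close>

text \<open>\<open>ends e\<close> is the set of end points of the edge \<open>e\<close>; it is a singleton if \<open>e\<close> is a loop.\<close>

record ('v, 'e) multigraph =
  verts :: "'v set"
  edges :: "'e set"
  ends :: "'e \<Rightarrow> 'v set"

fun mg_walk :: "('v, 'e) multigraph \<Rightarrow> 'v \<Rightarrow> 'e list \<Rightarrow> 'v \<Rightarrow> bool" where
  "mg_walk \<Gamma> u [] v \<longleftrightarrow> u \<in> verts \<Gamma> \<and> u = v"
| "mg_walk \<Gamma> u (e # es) v \<longleftrightarrow>
     u \<in> verts \<Gamma> \<and> e \<in> edges \<Gamma> \<and> (\<exists>w. ends \<Gamma> e = {u, w} \<and> mg_walk \<Gamma> w es v)"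

definition mg_connected :: "('v, 'e) multigraph \<Rightarrow> bool" where
  "mg_connected \<Gamma> \<longleftrightarrow>
     verts \<Gamma> \<noteq> {} \<and> (\<forall>u\<in>verts \<Gamma>. \<forall>v\<in>verts \<Gamma>. \<exists>es. mg_walk \<Gamma> u es v)"

definition mg_component_of :: "('v, 'e) multigraph \<Rightarrow> 'v \<Rightarrow> ('v, 'e) multigraph" where
  "mg_component_of \<Gamma> u =
     (let V = {v. \<exists>es. mg_walk \<Gamma> u es v}
      in \<lparr> verts = V, edges = {e \<in> edges \<Gamma>. ends \<Gamma> e \<subseteq> V}, ends = ends \<Gamma> \<rparr>)"

definition mg_components :: "('v, 'e) multigraph \<Rightarrow> ('v, 'e) multigraph set" where
  "mg_components \<Gamma> = mg_component_of \<Gamma> ` verts \<Gamma>"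

definition mg_isomorphic :: "('v, 'e) multigraph \<Rightarrow> ('w, 'f) multigraph \<Rightarrow> bool" where
  "mg_isomorphic \<Gamma> \<Delta> \<longleftrightarrow>
     (\<exists>f g. bij_betw f (verts \<Gamma>) (verts \<Delta>) \<and> bij_betw g (edges \<Gamma>) (edges \<Delta>) \<and>
        (\<forall>e\<in>edges \<Gamma>. ends \<Delta> (g e) = f ` ends \<Gamma> e))"

definition mg_bipartite :: "('v, 'e) multigraph \<Rightarrow> bool" where
  "mg_bipartite \<Gamma> \<longleftrightarrow>
     (\<exists>A B. A \<union> B = verts \<Gamma> \<and> A \<inter> B = {} \<and>
        (\<forall>e\<in>edges \<Gamma>. \<exists>a\<in>A. \<exists>b\<in>B. ends \<Gamma> e = {a, b}))"

text \<open>A loop contributes 2 to the degree.\<close>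

definition mg_degree :: "('v, 'e) multigraph \<Rightarrow> 'v \<Rightarrow> nat" where
  "mg_degree \<Gamma> v = card {e \<in> edges \<Gamma>. v \<in> ends \<Gamma> e} + card {e \<in> edges \<Gamma>. ends \<Gamma> e = {v}}"

definition mg_dist :: "('v, 'e) multigraph \<Rightarrow> 'v \<Rightarrow> 'v \<Rightarrow> enat" where
  "mg_dist \<Gamma> u v = Inf {enat (length es) | es. mg_walk \<Gamma> u es v}"

definition mg_diameter :: "('v, 'e) multigraph \<Rightarrow> enat" where
  "mg_diameter \<Gamma> = Sup {mg_dist \<Gamma> u v | u v. u \<in> verts \<Gamma> \<and> v \<in> verts \<Gamma>}"

definition mg_girth :: "('v, 'e) multigraph \<Rightarrow> enat" where
  "mg_girth \<Gamma> = Inf {enat (length es) | u es. es \<noteq> [] \<and> mg_walk \<Gamma> u es u \<and> distinct_adj es}"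

section \<open>Star graphs and special presentations\<close>

definition symmetrized_relators :: "'a presentation \<Rightarrow> 'a word set" where
  "symmetrized_relators P = {rotate k r | k r. r \<in> rels P \<union> inv_word ` rels P}"

text \<open>The word \<open>x y\<^sup>-\<^sup>1 u\<close> is sent to \<open>y x\<^sup>-\<^sup>1 u\<^sup>-\<^sup>1\<close>.\<close>

fun star_partner :: "'a word \<Rightarrow> 'a word" where
  "star_partner (a # b # u) = inv_letter b # inv_letter a # inv_word u"
| "star_partner w = w"

text \<open>An edge is an inverse pair \<open>{x y\<^sup>-\<^sup>1 u, y x\<^sup>-\<^sup>1 u\<^sup>-\<^sup>1}\<close>; its end points \<open>x\<close> and \<open>y\<close> are
  the first letters of the two words.\<close>

definition star_graph :: "'a presentation \<Rightarrow> ('a letter, 'a word set) multigraph" where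
  "star_graph P =
     \<lparr> verts = gens P \<times> UNIV,
       edges = {{w, star_partner w} | w. w \<in> symmetrized_relators P \<and> length w \<ge> 2},
       ends = (\<lambda>E. hd ` E) \<rparr>"

definition special_presentation :: "nat \<Rightarrow> nat \<Rightarrow> nat \<Rightarrow> 'a presentation \<Rightarrow> bool" where
  "special_presentation m k \<nu> P \<longleftrightarrow>
     m \<ge> 2 \<and> k \<ge> 3 \<and> \<nu> \<ge> 1 \<and>
     finite_cyclically_reduced_presentation P \<and>
     card (mg_components (star_graph P)) = \<nu> \<and>
     (\<forall>\<Gamma>\<in>mg_components (star_graph P). \<forall>\<Delta>\<in>mg_components (star_graph P). mg_isomorphic \<Gamma> \<Delta>) \<and>
     (\<forall>\<Gamma>\<in>mg_components (star_graph P).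
        mg_connected \<Gamma> \<and> mg_bipartite \<Gamma> \<and>
        mg_diameter \<Gamma> = enat m \<and> mg_girth \<Gamma> = enat (2 * m) \<and>
        (\<forall>v\<in>verts \<Gamma>. mg_degree \<Gamma> v \<ge> 3)) \<and>
     (\<forall>r\<in>rels P. length r = k) \<and>
     (m = 2 \<longrightarrow> k \<ge> 4)"

definition contains_copy_of :: "('a, 'c) monoid_scheme \<Rightarrow> ('b, 'd) monoid_scheme \<Rightarrow> bool" where
  "contains_copy_of G K \<longleftrightarrow> (\<exists>H. subgroup H G \<and> (G\<lparr>carrier := H\<rparr>) \<cong> K)"

end

theory Submission
  imports Defs "HOL-Algebra.Bij"
begin

text \<open>Let \<open>q\<^sub>4 = -(q\<^sub>1 + q\<^sub>2 + q\<^sub>3)\<close>. The star graph joins \<open>x\<^sub>k\<close> to \<open>x\<^bsub>k+q\<^esub>\<^sup>-\<^sup>1\<close> for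
  \<open>q \<in> {q\<^sub>1, q\<^sub>2, q\<^sub>3, q\<^sub>4}\<close>. Girth 4 and degree at least 3 force the \<open>q\<^sub>i\<close> to be distinct, and
  diameter 2 forces the set of the \<open>q\<^sub>i\<close> to be a coset of a subgroup of order 4 of \<open>\<int>/n\<close>. As its sum is 0,
  \<open>8q\<^sub>i = 0\<close> for all \<open>i\<close>, so irreducibility gives \<open>n dvd 8\<close>, then \<open>n = 8\<close>, and the \<open>q\<^sub>i\<close> are
  the four odd residues. Conversely, in that case the star graph is a disjoint union of two copies of
  the complete bipartite graph on 4 + 4 vertices. The isomorphisms come from units of \<open>\<int>/8\<close> acting on the subscripts.

  Once the vertex of the presentation complex is split according to the two components of its link,
  the universal cover is a product of two trees. For \<open>x\<^sub>0x\<^sub>1x\<^sub>4x\<^sub>1\<close>,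
  walking along one tree permutes the edge labels of the other in a way that only depends on the
  classes \<open>{i, i+4}\<close> of the labels crossed; hence \<open>x\<^sub>0x\<^sub>4\<^sup>-\<^sup>1, x\<^sub>2x\<^sub>6\<^sup>-\<^sup>1\<close> commute with
  \<open>x\<^sub>5\<^sup>-\<^sup>1x\<^sub>1, x\<^sub>7\<^sup>-\<^sup>1x\<^sub>3\<close>, and the actions on the two trees show that these four elements generate
  a direct product of two free groups.\<close>

section \<open>Evaluation of words and von Dyck's theorem\<close>

definition eval_letter :: "('b, 'c) monoid_scheme \<Rightarrow> ('a \<Rightarrow> 'b) \<Rightarrow> 'a letter \<Rightarrow> 'b" where
  "eval_letter G f a = (if snd a then f (fst a) else inv\<^bsub>G\<^esub> f (fst a))"

definition eval_word :: "('b, 'c) monoid_scheme \<Rightarrow> ('a \<Rightarrow> 'b) \<Rightarrow> 'a word \<Rightarrow> 'b" where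
  "eval_word G f w = foldr (\<lambda>a y. eval_letter G f a \<otimes>\<^bsub>G\<^esub> y) w \<one>\<^bsub>G\<^esub>"

lemma eval_word_simps [simp]:
  "eval_word G f [] = \<one>\<^bsub>G\<^esub>"
  "eval_word G f (a # w) = eval_letter G f a \<otimes>\<^bsub>G\<^esub> eval_word G f w"
  by (simp_all add: eval_word_def)

lemma eval_word_cong:
  "(\<And>x. x \<in> fst ` set w \<Longrightarrow> f x = g x) \<Longrightarrow> eval_word G f w = eval_word G g w"
  by (induction w) (auto simp: eval_letter_def)

lemma eval_word_map:
  "eval_word G f (map (map_prod g id) w) = eval_word G (f \<circ> g) w"
  by (induction w) (auto simp: eval_letter_def)

context group
begin

lemma eval_letter_closed: "f (fst a) \<in> carrier G \<Longrightarrow> eval_letter G f a \<in> carrier G"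
  by (simp add: eval_letter_def)

lemma eval_word_closed: "f ` fst ` set w \<subseteq> carrier G \<Longrightarrow> eval_word G f w \<in> carrier G"
  by (induction w) (auto simp: eval_letter_closed)

lemma eval_word_append:
  "f ` fst ` set u \<subseteq> carrier G \<Longrightarrow> f ` fst ` set v \<subseteq> carrier G \<Longrightarrow>
    eval_word G f (u @ v) = eval_word G f u \<otimes> eval_word G f v"
  by (induction u) (auto simp: eval_letter_closed eval_word_closed m_assoc)

lemma eval_letter_inv_letter:
  "f (fst a) \<in> carrier G \<Longrightarrow> eval_letter G f (inv_letter a) = inv (eval_letter G f a)"
  by (simp add: eval_letter_def inv_letter_def)

lemma eval_word_cons_reduce:
  assumes "f ` fst ` set (a # w) \<subseteq> carrier G"
  shows "eval_word G f (cons_reduce a w) = eval_word G f (a # w)"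
proof (cases w)
  case (Cons b v)
  have "eval_letter G f a \<otimes> (inv (eval_letter G f a) \<otimes> eval_word G f v) = eval_word G f v"
    using assms Cons by (simp add: inv_solve_left eval_letter_closed eval_word_closed flip: m_assoc)
  with assms Cons show ?thesis
    by (auto simp: eval_letter_inv_letter)
qed simp

text \<open>Cancelling a letter against its inverse keeps the value, so evaluation respects the
  product of the free group, which is concatenation followed by reduction.\<close>

lemma eval_word_free_reduce:
  "f ` fst ` set w \<subseteq> carrier G \<Longrightarrow> eval_word G f (free_reduce w) = eval_word G f w"
proof (induction w)
  case (Cons a w)
  then have "f ` fst ` set (a # free_reduce w) \<subseteq> carrier G"
    using set_free_reduce[of w] by auto
  with Cons eval_word_cons_reduce[of f a "free_reduce w"] show ?case
    by (simp add: free_reduce_def)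
qed (simp add: free_reduce_def)

lemma eval_word_hom:
  assumes "f ` X \<subseteq> carrier G"
  shows "eval_word G f \<in> hom (free_group X) G"
proof (rule homI)
  fix u assume "u \<in> carrier (free_group X)"
  with assms show "eval_word G f u \<in> carrier G"
    by (intro eval_word_closed) (auto simp: free_group_def)
next
  fix u v assume "u \<in> carrier (free_group X)" "v \<in> carrier (free_group X)"
  then have "fst ` set u \<subseteq> X" "fst ` set v \<subseteq> X"
    by (simp_all add: free_group_def)
  then have "f ` fst ` set u \<subseteq> carrier G" "f ` fst ` set v \<subseteq> carrier G"
    using assms by blast+
  then show "eval_word G f (u \<otimes>\<^bsub>free_group X\<^esub> v) = eval_word G f u \<otimes> eval_word G f v"
    using eval_word_free_reduce[of f "u @ v"]
    by (simp add: free_group_def eval_word_append image_Un)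
qed

lemma hom_eval_word:
  assumes "group H" "h \<in> hom G H" "f ` fst ` set w \<subseteq> carrier G"
  shows "h (eval_word G f w) = eval_word H (h \<circ> f) w"
  using assms(3)
proof (induction w)
  case Nil
  then show ?case using hom_one[OF assms(2) group_axioms assms(1)] by simp
next
  case (Cons a w)
  have closed: "eval_letter G f a \<in> carrier G" "eval_word G f w \<in> carrier G"
    using Cons.prems eval_letter_closed[of f a] eval_word_closed[of f w] by auto
  interpret group_hom G H h
    using assms by (simp add: group_hom_def group_hom_axioms_def group_axioms)
  have "h (eval_letter G f a) = eval_letter H (h \<circ> f) a"
    using Cons.prems by (simp add: eval_letter_def)
  with closed show ?case
    using Cons by (simp add: comp_def)
qed

lemma eval_word_commute:
  assumes "f ` fst ` set w \<subseteq> carrier G" "g \<in> carrier G"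
    and "\<And>x. x \<in> fst ` set w \<Longrightarrow> f x \<otimes> g = g \<otimes> f x"
  shows "eval_word G f w \<otimes> g = g \<otimes> eval_word G f w"
  using assms(1,3)
proof (induction w)
  case (Cons a w)
  have fa: "f (fst a) \<in> carrier G" "f (fst a) \<otimes> g = g \<otimes> f (fst a)"
    using Cons.prems by auto
  \<comment> \<open>Commuting with an element implies commuting with its inverse; this covers the
    letters of sign \<open>False\<close>.\<close>
  then have "g = inv (f (fst a)) \<otimes> (g \<otimes> f (fst a))"
    using assms(2) fa(1) by (simp add: fa(2)[symmetric] m_assoc[symmetric])
  then have "inv (f (fst a)) \<otimes> g = g \<otimes> inv (f (fst a))"
    using fa assms(2) inv_solve_right[of "inv (f (fst a)) \<otimes> g" g "f (fst a)"]
    by (simp add: m_assoc)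
  with fa have a: "eval_letter G f a \<otimes> g = g \<otimes> eval_letter G f a"
    by (simp add: eval_letter_def)
  have cl: "eval_letter G f a \<in> carrier G" "eval_word G f w \<in> carrier G"
    using Cons.prems by (auto simp: eval_letter_closed eval_word_closed)
  have "eval_word G f w \<otimes> g = g \<otimes> eval_word G f w"
    using Cons by auto
  with a cl assms(2) have "eval_letter G f a \<otimes> (eval_word G f w \<otimes> g) =
      g \<otimes> (eval_letter G f a \<otimes> eval_word G f w)"
    by (simp flip: m_assoc)
  with cl assms(2) show ?case
    by (simp add: m_assoc)
qed (use assms in simp)

text \<open>From \<open>u v = 1\<close> follows \<open>v u = 1\<close>; hence a relator may be
  replaced by any of its cyclic permutations.\<close>

lemma eval_word_rotate:
  assumes "f ` fst ` set w \<subseteq> carrier G" "eval_word G f w = \<one>"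
  shows "eval_word G f (rotate k w) = \<one>"
proof -
  have "eval_word G f (v @ u) = \<one>"
    if "f ` fst ` set (u @ v) \<subseteq> carrier G" "eval_word G f (u @ v) = \<one>" for u v
  proof -
    have uv: "f ` fst ` set u \<subseteq> carrier G" "f ` fst ` set v \<subseteq> carrier G"
      using that(1) by (auto simp: image_Un)
    with that(2) show ?thesis
      by (simp add: eval_word_append inv_comm[OF _ eval_word_closed eval_word_closed])
  qed
  from this[of "take (k mod length w) w" "drop (k mod length w) w"] assms show ?thesis
    by (simp add: rotate_drop_take)
qed

end

section \<open>Normal closures and the universal property of a presented group\<close>

lemma normal_normal_closure:
  assumes "group G" "S \<subseteq> carrier G"
  shows "normal_closure G S \<lhd> G"
proof -
  interpret group G by fact
  \<comment> \<open>The whole group shows that the intersected family is nonempty; an empty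
    intersection would be \<open>UNIV\<close>.\<close>
  have car: "carrier G \<in> {N. N \<lhd> G \<and> S \<subseteq> N}"
    using assms(2) by (auto intro!: normal_invI subgroup_self)
  have "subgroup (normal_closure G S) G"
    unfolding normal_closure_def using car
    by (intro subgroups_Inter) (auto simp: normal_imp_subgroup)
  then show ?thesis
  proof (rule normal_invI)
    fix x h assume "x \<in> carrier G" "h \<in> normal_closure G S"
    then show "x \<otimes>\<^bsub>G\<^esub> h \<otimes>\<^bsub>G\<^esub> inv\<^bsub>G\<^esub> x \<in> normal_closure G S"
      by (auto simp: normal_closure_def normal_inv_iff)
  qed
qed

lemma subset_normal_closure: "S \<subseteq> normal_closure G S"
  by (auto simp: normal_closure_def)

lemma singleton_in_free_group: "x \<in> X \<Longrightarrow> [(x, e)] \<in> carrier (free_group X)"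
  by (simp add: free_group_def)

lemma inv_singleton_free_group:
  "x \<in> X \<Longrightarrow> inv\<^bsub>free_group X\<^esub> [(x, True)] = [(x, False)]"
  by (rule group.inv_equality[OF group_free_group])
    (auto simp: singleton_in_free_group, simp add: free_group_def free_reduce_def inv_letter_def)

lemma eval_word_free_group:
  assumes "w \<in> carrier (free_group X)"
  shows "eval_word (free_group X) (\<lambda>x. [(x, True)]) w = w"
  using assms
proof (induction w)
  case (Cons a w)
  then have a: "fst a \<in> X" and w: "w \<in> carrier (free_group X)" and red: "reduced_word (a # w)"
    by (auto simp: free_group_def dest: reduced_word_ConsD)
  have "eval_letter (free_group X) (\<lambda>x. [(x, True)]) a = [a]"
    using a by (cases a) (auto simp: eval_letter_def inv_singleton_free_group)
  moreover have "[a] \<otimes>\<^bsub>free_group X\<^esub> w = a # w"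
    using free_reduce_reduced[OF red] by (simp add: free_group_def)
  ultimately show ?case
    using Cons.IH[OF w] by simp
qed (simp add: free_group_def)

definition presented_gen :: "'a presentation \<Rightarrow> 'a \<Rightarrow> 'a word set" where
  "presented_gen P x =
     normal_closure (free_group (gens P)) (rels P) #>\<^bsub>free_group (gens P)\<^esub> [(x, True)]"

locale presentation =
  fixes P :: "'a presentation" (structure)
  assumes rels: "rels P \<subseteq> carrier (free_group (gens P))"
begin

abbreviation "F \<equiv> free_group (gens P)"
abbreviation "N \<equiv> normal_closure F (rels P)"

lemma normal: "N \<lhd> F"
  by (rule normal_normal_closure[OF group_free_group rels])

lemma group: "group (presented_group P)"
  unfolding presented_group_def by (rule normal.factorgroup_is_group[OF normal])

lemma coset_hom: "(\<lambda>w. N #>\<^bsub>F\<^esub> w) \<in> hom F (presented_group P)"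
  unfolding presented_group_def by (rule normal.r_coset_hom_Mod[OF normal])

lemma presented_gen_closed: "x \<in> gens P \<Longrightarrow> presented_gen P x \<in> carrier (presented_group P)"
  unfolding presented_gen_def by (rule hom_in_carrier[OF coset_hom singleton_in_free_group])

text \<open>A reduced word is its own value at the basis letters, and the quotient map commutes with
  evaluation. Cosets can thus be treated as products of generators.\<close>

lemma coset_eq_eval_word:
  assumes "w \<in> carrier F"
  shows "N #>\<^bsub>F\<^esub> w = eval_word (presented_group P) (presented_gen P) w"
proof -
  have "fst ` set w \<subseteq> gens P"
    using assms by (auto simp: free_group_def)
  then have "(\<lambda>x. [(x, True)]) ` fst ` set w \<subseteq> carrier F"
    by (auto intro!: singleton_in_free_group)
  from group.hom_eval_word[OF group_free_group group coset_hom this] show ?thesis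
    by (simp add: eval_word_free_group[OF assms] comp_def presented_gen_def[abs_def])
qed

lemma eval_relator:
  assumes "r \<in> rels P"
  shows "eval_word (presented_group P) (presented_gen P) r = \<one>\<^bsub>presented_group P\<^esub>"
proof -
  have r: "r \<in> carrier F" using assms rels by blast
  moreover have "r \<in> N" using assms subset_normal_closure[of "rels P" F] by blast
  ultimately have "N #>\<^bsub>F\<^esub> r = N"
    by (intro group.coset_join2[OF group_free_group] normal_imp_subgroup[OF normal])
  then show ?thesis
    using coset_eq_eval_word[OF r] by (simp add: presented_group_def)
qed

lemma carrier_eq: "carrier (presented_group P) =
    eval_word (presented_group P) (presented_gen P) ` carrier F"
  using coset_eq_eval_word
  by (auto simp: presented_group_def carrier_FactGroup image_iff)

text \<open>The kernel of evaluation at \<open>f\<close> is normal and contains the relators, hence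
  their normal closure, so evaluation factors through the quotient.\<close>

lemma universal:
  assumes "group H" "f ` gens P \<subseteq> carrier H"
    and "\<And>r. r \<in> rels P \<Longrightarrow> eval_word H f r = \<one>\<^bsub>H\<^esub>"
  obtains h where "h \<in> hom (presented_group P) H" "\<And>x. x \<in> gens P \<Longrightarrow> h (presented_gen P x) = f x"
proof -
  interpret H: group H by fact
  interpret group_hom F H "eval_word H f"
    using assms(1,2) group_free_group
    by (simp add: group_hom_def group_hom_axioms_def H.eval_word_hom)
  have "rels P \<subseteq> kernel F H (eval_word H f)"
    using assms(3) rels by (auto simp: kernel_def)
  then have "N \<subseteq> kernel F H (eval_word H f)"
    using normal_kernel by (auto simp: normal_closure_def)
  from FactGroup_universal_kernel[OF normal this] obtain h where
    h: "h \<in> hom (F Mod N) H" "\<And>w. w \<in> carrier F \<Longrightarrow> h (N #>\<^bsub>F\<^esub> w) = eval_word H f w"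
    by blast
  show thesis
  proof (rule that)
    show "h \<in> hom (presented_group P) H"
      using h(1) by (simp add: presented_group_def)
    fix x assume "x \<in> gens P"
    with h(2)[OF singleton_in_free_group[OF this, of True]] assms(2)
    show "h (presented_gen P x) = f x"
      by (auto simp: presented_gen_def eval_letter_def)
  qed
qed

text \<open>This is the uniqueness half of the universal property; it is applied to composites of
  two induced homomorphisms.\<close>

lemma hom_id:
  assumes "h \<in> hom (presented_group P) (presented_group P)"
    and "\<And>x. x \<in> gens P \<Longrightarrow> h (presented_gen P x) = presented_gen P x"
    and "g \<in> carrier (presented_group P)"
  shows "h g = g"
proof -
  obtain w where w: "w \<in> carrier F" "g = eval_word (presented_group P) (presented_gen P) w"
    using assms(3) carrier_eq by auto
  then have sub: "fst ` set w \<subseteq> gens P"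
    by (auto simp: free_group_def)
  then have "h g = eval_word (presented_group P) (h \<circ> presented_gen P) w"
    unfolding w(2) using presented_gen_closed
    by (intro group.hom_eval_word[OF group group assms(1)]) auto
  also have "\<dots> = g"
    unfolding w(2) using sub assms(2) by (intro eval_word_cong) auto
  finally show ?thesis .
qed

end

text \<open>The maps of generators induce homomorphisms both ways by \<open>universal\<close>, and
  their composites are identities by \<open>hom_id\<close>. The relators need not correspond to each
  other; each has to hold in the other group.\<close>

lemma presented_group_isoI:
  assumes "presentation P" "presentation Q"
    and \<sigma>: "\<And>x. x \<in> gens P \<Longrightarrow> \<sigma> x \<in> gens Q \<and> \<tau> (\<sigma> x) = x"
    and \<tau>: "\<And>y. y \<in> gens Q \<Longrightarrow> \<tau> y \<in> gens P \<and> \<sigma> (\<tau> y) = y"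
    and relP: "\<And>r. r \<in> rels P \<Longrightarrow>
      eval_word (presented_group Q) (presented_gen Q \<circ> \<sigma>) r = \<one>\<^bsub>presented_group Q\<^esub>"
    and relQ: "\<And>r. r \<in> rels Q \<Longrightarrow>
      eval_word (presented_group P) (presented_gen P \<circ> \<tau>) r = \<one>\<^bsub>presented_group P\<^esub>"
  shows "presented_group P \<cong> presented_group Q"
proof -
  interpret P: presentation P by fact
  interpret Q: presentation Q by fact
  obtain h where h: "h \<in> hom (presented_group P) (presented_group Q)"
    "\<And>x. x \<in> gens P \<Longrightarrow> h (presented_gen P x) = presented_gen Q (\<sigma> x)"
    using P.universal[OF Q.group _ relP] Q.presented_gen_closed \<sigma> by (auto simp: image_subset_iff)
  obtain k where k: "k \<in> hom (presented_group Q) (presented_group P)"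
    "\<And>x. x \<in> gens Q \<Longrightarrow> k (presented_gen Q x) = presented_gen P (\<tau> x)"
    using Q.universal[OF P.group _ relQ] P.presented_gen_closed \<tau> by (auto simp: image_subset_iff)
  have kh: "k (h g) = g" if "g \<in> carrier (presented_group P)" for g
    using P.hom_id[OF hom_compose[OF h(1) k(1)] _ that] h k \<sigma> by (simp add: comp_def)
  have hk: "h (k g) = g" if "g \<in> carrier (presented_group Q)" for g
    using Q.hom_id[OF hom_compose[OF k(1) h(1)] _ that] h k \<tau> by (simp add: comp_def)
  have "bij_betw h (carrier (presented_group P)) (carrier (presented_group Q))"
    using kh hk hom_in_carrier[OF h(1)] hom_in_carrier[OF k(1)]
    by (intro bij_betwI[where g = k]) auto
  with h(1) show ?thesis
    by (auto simp: is_iso_def iso_def)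
qed

section \<open>Isomorphisms of cyclically presented groups\<close>

lemma shift_positive_word:
  "(shift n ^^ k) (positive_word n is) = positive_word n (map (\<lambda>i. i + k) is)"
  by (induction k) (auto simp: shift_def positive_word_def mod_Suc_eq)

lemma rels_cyclic_presentation_positive:
  "rels (cyclic_presentation n (positive_word n is)) =
     {positive_word n (map (\<lambda>i. i + k) is) | k. k < n}"
  by (simp add: cyclic_presentation_def shift_positive_word)

lemma reduced_positive_word: "reduced_word (positive_word n is)"
  unfolding reduced_word_def
  by (rule successively_if_sorted_wrt, rule sorted_wrt_iff_nth_less[THEN iffD2])
    (auto simp: positive_word_def inv_letter_def)

lemma positive_word_in_free_group:
  "n > 0 \<Longrightarrow> positive_word n is \<in> carrier (free_group {..<n})"
  using reduced_positive_word[of n "is"] by (auto simp: free_group_def positive_word_def)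

lemma gens_cyclic_presentation [simp]: "gens (cyclic_presentation n w) = {..<n}"
  by (simp add: cyclic_presentation_def)

lemma presentation_cyclic_positive:
  "n > 0 \<Longrightarrow> presentation (cyclic_presentation n (positive_word n is))"
  by unfold_locales (auto simp: rels_cyclic_presentation_positive intro!: positive_word_in_free_group)

lemma positive_word_in_rels:
  assumes "n > 0"
  shows "positive_word n (map (\<lambda>i. i + k) is) \<in> rels (cyclic_presentation n (positive_word n is))"
proof -
  have "positive_word n (map (\<lambda>i. i + k) is) = positive_word n (map (\<lambda>i. i + k mod n) is)"
    by (simp add: positive_word_def mod_simps)
  moreover have "k mod n < n" using assms by simp
  ultimately show ?thesis
    unfolding rels_cyclic_presentation_positive by blast
qed

lemma rotate_inverse: "\<exists>l. rotate l (rotate k w) = w"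
proof (cases "w = []")
  case False
  \<comment> \<open>Rotating by \<open>k\<close> and then by \<open>k * (length w - 1)\<close>
    amounts to \<open>k\<close> full turns.\<close>
  then have "k * (length w - 1) + k = k * length w"
    by (cases "length w") auto
  then have "rotate (k * (length w - 1)) (rotate k w) = w"
    unfolding rotate_rotate by (subst rotate_conv_mod) simp
  then show ?thesis ..
qed simp

text \<open>Multiplying all subscripts by a unit permutes the generators, adding a constant to them
  permutes the relators, and rotating a relator does not change its normal closure.\<close>

lemma cyclically_presented_group_iso:
  assumes "n > 0" and "coprime u n"
    and js: "map (\<lambda>j. j mod n) js = rotate k (map (\<lambda>i. (u * i + c) mod n) is)"
  shows "cyclically_presented_group n (positive_word n is) \<cong>
    cyclically_presented_group n (positive_word n js)"
proof -
  define P Q where "P = cyclic_presentation n (positive_word n is)"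
    and "Q = cyclic_presentation n (positive_word n js)"
  interpret P: presentation P
    unfolding P_def by (rule presentation_cyclic_positive[OF assms(1)])
  interpret Q: presentation Q
    unfolding Q_def by (rule presentation_cyclic_positive[OF assms(1)])
  interpret GP: group "presented_group P" by (rule P.group)
  interpret GQ: group "presented_group Q" by (rule Q.group)
  obtain v where v: "[u * v = 1] (mod n)"
    using cong_solve_coprime_nat[OF assms(2)] by auto
  have vu: "(v * (u * x)) mod n = x mod n" and uv: "(u * (v * x)) mod n = x mod n" for x
    using cong_mult[OF v cong_refl[of x n]] by (simp_all add: cong_def mult_ac)
  have gens: "gens P = {..<n}" "gens Q = {..<n}"
    by (simp_all add: P_def Q_def)
  have pgP: "presented_gen P ` fst ` set (positive_word n ks) \<subseteq> carrier (presented_group P)" for ks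
    using P.presented_gen_closed gens assms(1) by (auto simp: positive_word_def)
  have pgQ: "presented_gen Q ` fst ` set (positive_word n ks) \<subseteq> carrier (presented_group Q)" for ks
    using Q.presented_gen_closed gens assms(1) by (auto simp: positive_word_def)
  have mult_word: "map (map_prod (\<lambda>x. (a * x) mod n) id) (positive_word n ks) =
      positive_word n (map (\<lambda>i. a * i) ks)" for a ks
    by (simp add: positive_word_def mod_simps)
  \<comment> \<open>A map \<open>g\<close> of subscripts that respects residues can be applied to
    both sides of the assumption \<open>js\<close>. It will be a translation, and then a translation
    followed by multiplication by \<open>v\<close>.\<close>
  have rot: "positive_word n (map g js) = rotate k (positive_word n (map (\<lambda>i. g (u * i + c)) is))"
    if "\<And>x. g (x mod n) mod n = g x mod n" for g
  proof -
    have "map (\<lambda>j. g j mod n) js = map (\<lambda>x. g x mod n) (map (\<lambda>j. j mod n) js)"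
      using that by simp
    also have "\<dots> = rotate k (map (\<lambda>i. g (u * i + c) mod n) is)"
      unfolding js using that by (simp add: rotate_map)
    finally have "map (\<lambda>x. (x, True)) (map (\<lambda>j. g j mod n) js) =
        map (\<lambda>x. (x, True)) (rotate k (map (\<lambda>i. g (u * i + c) mod n) is))"
      by (rule arg_cong)
    then show ?thesis
      by (simp add: positive_word_def rotate_map comp_def)
  qed
  have "presented_group P \<cong> presented_group Q"
  proof (rule presented_group_isoI[OF P.presentation_axioms Q.presentation_axioms,
        where \<sigma> = "\<lambda>x. (u * x) mod n" and \<tau> = "\<lambda>x. (v * x) mod n"])
    fix r assume "r \<in> rels P"
    then obtain m where r: "r = positive_word n (map (\<lambda>i. i + m) is)"
      unfolding P_def rels_cyclic_presentation_positive by auto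
    \<comment> \<open>In natural numbers \<open>(n - 1) * c\<close> stands for \<open>-c\<close>, so
      a shift by \<open>m'\<close> removes the constant \<open>c\<close> and supplies
      \<open>u * m\<close>.\<close>
    define m' where "m' = u * m + (n - 1) * c"
    have m': "(u * i + c + m') mod n = (u * (i + m)) mod n" for i
    proof -
      have "u * i + c + m' = u * (i + m) + n * c"
        using assms(1) by (cases n) (auto simp: m'_def algebra_simps)
      then show ?thesis by simp
    qed
    have "positive_word n (map (\<lambda>j. j + m') js) =
        rotate k (positive_word n (map (\<lambda>i. u * (i + m)) is))"
      using m' by (subst rot) (auto simp: mod_simps positive_word_def comp_def)
    then obtain l where l: "positive_word n (map (\<lambda>i. u * (i + m)) is) =
        rotate l (positive_word n (map (\<lambda>j. j + m') js))"
      using rotate_inverse[of k "positive_word n (map (\<lambda>i. u * (i + m)) is)"] by metis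
    have "eval_word (presented_group Q) (presented_gen Q) (positive_word n (map (\<lambda>i. u * (i + m)) is))
        = \<one>\<^bsub>presented_group Q\<^esub>"
      unfolding l
      by (rule GQ.eval_word_rotate[OF pgQ Q.eval_relator])
        (simp add: Q_def positive_word_in_rels[OF assms(1)])
    then show "eval_word (presented_group Q) (presented_gen Q \<circ> (\<lambda>x. (u * x) mod n)) r =
        \<one>\<^bsub>presented_group Q\<^esub>"
      unfolding r eval_word_map[symmetric] mult_word by (simp add: comp_def)
  next
    fix r assume "r \<in> rels Q"
    then obtain m where r: "r = positive_word n (map (\<lambda>i. i + m) js)"
      unfolding Q_def rels_cyclic_presentation_positive by auto
    \<comment> \<open>Since \<open>v u = 1\<close> modulo \<open>n\<close>,
      \<open>v (u i + c + m)\<close> is \<open>i\<close> plus a constant, so the word is a rotation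
      of a relator of \<open>P\<close>.\<close>
    have "positive_word n (map (\<lambda>j. v * (j + m)) js) =
        rotate k (positive_word n (map (\<lambda>i. i + (v * c + v * m)) is))"
    proof (subst rot)
      have "(v * (u * i + c + m)) mod n = (i + (v * c + v * m)) mod n" for i
        using mod_add_cong[OF vu[of i] refl[of "(v * c + v * m) mod n"]]
        by (simp add: algebra_simps)
      then show "rotate k (positive_word n (map (\<lambda>i. v * (u * i + c + m)) is)) =
          rotate k (positive_word n (map (\<lambda>i. i + (v * c + v * m)) is))"
        by (simp add: positive_word_def comp_def)
    next
      show "v * (x mod n + m) mod n = v * (x + m) mod n" for x
        by (metis mod_add_left_eq mod_mult_right_eq)
    qed
    moreover have "eval_word (presented_group P) (presented_gen P)
        (rotate k (positive_word n (map (\<lambda>i. i + (v * c + v * m)) is))) = \<one>\<^bsub>presented_group P\<^esub>"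
      by (rule GP.eval_word_rotate[OF pgP P.eval_relator])
        (simp add: P_def positive_word_in_rels[OF assms(1)])
    ultimately show "eval_word (presented_group P) (presented_gen P \<circ> (\<lambda>x. (v * x) mod n)) r =
        \<one>\<^bsub>presented_group P\<^esub>"
      unfolding r eval_word_map[symmetric] mult_word by (simp add: comp_def)
  qed (use assms(1) in \<open>auto simp: gens mod_simps vu uv\<close>)
  then show ?thesis
    by (simp add: cyclically_presented_group_def P_def Q_def)
qed

section \<open>A subgroup isomorphic to the direct square of the free group of rank 2\<close>

context group
begin

text \<open>The two commutation lemmas are the two ways in which a horizontal and a vertical edge path
  bound a rectangle in the square complex of the presentation.\<close>

lemma commute_if_squares_swap_horizontal:
  assumes [simp]: "p \<in> carrier G" "p' \<in> carrier G" "s \<in> carrier G" "s' \<in> carrier G"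
    and 1: "p \<otimes> s \<otimes> p' \<otimes> s = \<one>" and 2: "p' \<otimes> s' \<otimes> p \<otimes> s' = \<one>"
  shows "(p \<otimes> inv p') \<otimes> (inv s' \<otimes> s) = (inv s' \<otimes> s) \<otimes> (p \<otimes> inv p')"
proof -
  have "(s \<otimes> p \<otimes> s) \<otimes> p' = \<one>"
    using 1 inv_comm[of "p \<otimes> s \<otimes> p'" s] inv_comm[of "p'" "s \<otimes> p \<otimes> s"] by (simp add: m_assoc)
  then have sps: "inv p' = s \<otimes> p \<otimes> s"
    by (intro inv_equality) simp_all
  have "(s' \<otimes> p \<otimes> s') \<otimes> p' = \<one>"
    using 2 inv_comm[of "p'" "s' \<otimes> p \<otimes> s'"] by (simp add: m_assoc)
  then have sps': "inv p' = s' \<otimes> p \<otimes> s'"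
    by (intro inv_equality) simp_all
  \<comment> \<open>Both products equal \<open>p s' p s\<close>; the two expressions for the inverse
    of \<open>p'\<close> are used in turn.\<close>
  have "(p \<otimes> inv p') \<otimes> (inv s' \<otimes> s) = p \<otimes> s' \<otimes> p \<otimes> s"
    unfolding sps' by (simp add: m_assoc) (simp flip: m_assoc)
  also have "\<dots> = inv s' \<otimes> (s' \<otimes> p \<otimes> s') \<otimes> p \<otimes> s"
    by (simp flip: m_assoc)
  also have "\<dots> = (inv s' \<otimes> s) \<otimes> (p \<otimes> inv p')"
    unfolding sps'[symmetric] sps by (simp add: m_assoc)
  finally show ?thesis .
qed

lemma commute_if_squares_swap_vertical:
  assumes [simp]: "p \<in> carrier G" "p' \<in> carrier G" "t \<in> carrier G" "t' \<in> carrier G"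
    and 1: "t' \<otimes> p \<otimes> t \<otimes> p = \<one>" and 2: "t \<otimes> p' \<otimes> t' \<otimes> p' = \<one>"
  shows "(p \<otimes> inv p') \<otimes> (inv t' \<otimes> t) = (inv t' \<otimes> t) \<otimes> (p \<otimes> inv p')"
proof -
  have "(p \<otimes> t \<otimes> p) \<otimes> t' = \<one>"
    using 1 inv_comm[of t' "p \<otimes> t \<otimes> p"] by (simp add: m_assoc)
  then have ptp: "inv t' = p \<otimes> t \<otimes> p"
    by (intro inv_equality) simp_all
  have "(p' \<otimes> t \<otimes> p') \<otimes> t' = \<one>"
    using 2 inv_comm[of "t \<otimes> p'" "t' \<otimes> p'"] inv_comm[of t' "p' \<otimes> t \<otimes> p'"]
    by (simp add: m_assoc)
  then have ptp': "inv t' = p' \<otimes> t \<otimes> p'"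
    by (intro inv_equality) simp_all
  have "(p \<otimes> inv p') \<otimes> (inv t' \<otimes> t) = p \<otimes> t \<otimes> p' \<otimes> t"
    unfolding ptp' by (simp add: m_assoc) (simp flip: m_assoc)
  also have "\<dots> = p \<otimes> t \<otimes> (p' \<otimes> t \<otimes> p') \<otimes> inv p'"
    by (simp add: m_assoc)
  also have "\<dots> = (inv t' \<otimes> t) \<otimes> (p \<otimes> inv p')"
    unfolding ptp'[symmetric] ptp by (simp add: m_assoc)
  finally show ?thesis .
qed

end

section \<open>Permutation groups and an action on reduced words\<close>

lemma BijGroup_simps [simp]:
  "carrier (BijGroup S) = Bij S" "\<one>\<^bsub>BijGroup S\<^esub> = (\<lambda>x\<in>S. x)"
  "f \<in> Bij S \<Longrightarrow> g \<in> Bij S \<Longrightarrow> f \<otimes>\<^bsub>BijGroup S\<^esub> g = compose S f g"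
  by (simp_all add: BijGroup_def)

lemma restrict_Bij:
  assumes "\<And>x. x \<in> S \<Longrightarrow> f x \<in> S \<and> g (f x) = x" "\<And>x. x \<in> S \<Longrightarrow> g x \<in> S \<and> f (g x) = x"
  shows "restrict f S \<in> Bij S"
  using assms by (auto simp: Bij_def intro!: bij_betwI[where g = g])

lemma inv_restrict_BijGroup:
  assumes "\<And>x. x \<in> S \<Longrightarrow> f x \<in> S \<and> g (f x) = x" "\<And>x. x \<in> S \<Longrightarrow> g x \<in> S \<and> f (g x) = x"
  shows "inv\<^bsub>BijGroup S\<^esub> (restrict f S) = restrict g S"
  using assms restrict_Bij[of S f g] restrict_Bij[of S g f]
  by (intro group.inv_equality[OF group_BijGroup]) (auto simp: compose_def fun_eq_iff)

text \<open>The right factor of a product acts first, hence \<open>foldr\<close>. Checking a relator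
  in \<open>BijGroup\<close> becomes a pointwise computation.\<close>

lemma eval_positive_BijGroup:
  assumes "\<And>i. restrict (f i) S \<in> Bij S"
  shows "eval_word (BijGroup S) (\<lambda>i. restrict (f i) S) (map (\<lambda>i. (i, True)) is) =
    (\<lambda>x\<in>S. foldr f is x)"
proof (induction "is")
  case (Cons i "is")
  have "eval_word (BijGroup S) (\<lambda>i. restrict (f i) S) (map (\<lambda>i. (i, True)) is) \<in> Bij S"
    using group.eval_word_closed[OF group_BijGroup, of "\<lambda>i. restrict (f i) S"] assms
    by (auto simp: image_subset_iff)
  then have Bij: "(\<lambda>x\<in>S. foldr f is x) \<in> Bij S"
    unfolding Cons.IH .
  have "eval_word (BijGroup S) (\<lambda>i. restrict (f i) S) (map (\<lambda>i. (i, True)) (i # is)) =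
      compose S (restrict (f i) S) (\<lambda>x\<in>S. foldr f is x)"
    unfolding list.map eval_word_simps Cons.IH eval_letter_def fst_conv snd_conv if_True
    using assms Bij by (intro BijGroup_simps)
  also have "\<dots> = (\<lambda>x\<in>S. foldr f (i # is) x)"
    using funcset_mem[OF Bij_imp_funcset[OF Bij]] by (auto simp: compose_def intro!: restrict_ext)
  finally show ?case .
qed simp

abbreviation reduced_words :: "nat word set" where
  "reduced_words \<equiv> {w. reduced_word w}"

text \<open>On reduced words this is the automorphism of the free group that inverts the basis
  element \<open>y\<close> and fixes the others.\<close>

definition flip :: "'a \<Rightarrow> 'a word \<Rightarrow> 'a word" where
  "flip y = map (\<lambda>(x, e). (x, e \<noteq> (x = y)))"

lemma flip_flip [simp]: "flip y (flip y w) = w"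
  by (auto simp: flip_def intro!: map_idI)

lemma flip_cons_reduce:
  "flip y (cons_reduce (x, e) w) = cons_reduce (x, e \<noteq> (x = y)) (flip y w)"
  by (cases w) (auto simp: flip_def inv_letter_def)

lemma reduced_flip [simp]: "reduced_word (flip y w) \<longleftrightarrow> reduced_word w"
  by (simp add: reduced_word_def flip_def successively_map inv_letter_def case_prod_unfold)
     (rule arg_cong[where f = "\<lambda>P. successively P w"], auto simp: fun_eq_iff prod_eq_iff)

lemma cons_reduce_cons_reduce_inv:
  "reduced_word w \<Longrightarrow> cons_reduce (x, e) (cons_reduce (x, \<not> e) w) = w"
  using cons_reduce_cancel[of w "(x, e)"] by (simp add: inv_letter_def)

text \<open>A quotient of the action of the generators on one of the two trees of the universal cover: \<open>x\<^sub>0, x\<^sub>4\<close>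
  and \<open>x\<^sub>2, x\<^sub>6\<close> translate along the two generators of a free group, the other generators act
  through the finite group of sign changes. Conjugating by the shift gives the action on the other tree.\<close>

definition tree_action :: "nat \<Rightarrow> nat word \<Rightarrow> nat word" where
  "tree_action i =
     (if i = 0 then cons_reduce (0, True) else if i = 4 then cons_reduce (0, False)
      else if i = 2 then cons_reduce (1, True) else if i = 6 then cons_reduce (1, False)
      else if i mod 4 = 1 then flip 1 else flip 0)"

text \<open>For even \<open>i\<close> the subscripts \<open>i\<close> and \<open>i + 4\<close> act
  as opposite translations; for odd \<open>i\<close> the action is an involution.\<close>

definition tree_action_inv :: "nat \<Rightarrow> nat word \<Rightarrow> nat word" where
  "tree_action_inv i = tree_action (if even i then (i + 4) mod 8 else i)"

lemma less_8_cases: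
  fixes i :: nat assumes "i < 8"
  obtains "i = 0" | "i = 1" | "i = 2" | "i = 3" | "i = 4" | "i = 5" | "i = 6" | "i = 7"
  using assms by linarith

lemma tree_action_reduced: "reduced_word w \<Longrightarrow> reduced_word (tree_action i w)"
  by (simp add: tree_action_def reduced_cons_reduce)

lemma tree_action_inv_reduced: "reduced_word w \<Longrightarrow> reduced_word (tree_action_inv i w)"
  by (simp add: tree_action_inv_def tree_action_reduced)

lemma tree_action_inverse:
  assumes "i < 8" "reduced_word w"
  shows "tree_action i (tree_action_inv i w) = w" "tree_action_inv i (tree_action i w) = w"
proof -
  note simps = tree_action_def tree_action_inv_def
    cons_reduce_cons_reduce_inv[OF assms(2), of _ True, simplified]
    cons_reduce_cons_reduce_inv[OF assms(2), of _ False, simplified]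
  show "tree_action i (tree_action_inv i w) = w"
    using assms(1) by (cases i rule: less_8_cases) (simp_all add: simps)
  show "tree_action_inv i (tree_action i w) = w"
    using assms(1) by (cases i rule: less_8_cases) (simp_all add: simps)
qed

text \<open>For even \<open>i\<close> the two opposite translations are separated by a sign change
  of the other basis element, which commutes with them. For odd \<open>i\<close> the sign change
  inverts the translation between its two occurrences, so the two translations cancel.\<close>

lemma tree_action_relator:
  assumes "i < 8" "reduced_word w"
  shows "foldr tree_action [i, (i + 1) mod 8, (i + 4) mod 8, (i + 1) mod 8] w = w"
  using assms(1)
  by (cases i rule: less_8_cases)
    (simp_all add: tree_action_def flip_cons_reduce
      cons_reduce_cons_reduce_inv[OF assms(2), of _ True, simplified]
      cons_reduce_cons_reduce_inv[OF assms(2), of _ False, simplified])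

lemma restrict_tree_action_Bij: "i < 8 \<Longrightarrow> restrict (tree_action i) reduced_words \<in> Bij reduced_words"
  by (rule restrict_Bij[where g = "tree_action_inv i"])
    (auto simp: tree_action_inverse tree_action_reduced tree_action_inv_reduced)

lemma inv_tree_action:
  "i < 8 \<Longrightarrow> inv\<^bsub>BijGroup reduced_words\<^esub> (restrict (tree_action i) reduced_words) =
    restrict (tree_action_inv i) reduced_words"
  by (rule inv_restrict_BijGroup)
    (auto simp: tree_action_inverse tree_action_reduced tree_action_inv_reduced)

text \<open>The action of \<open>w\<close> carries the empty word to \<open>w\<close> with every
  letter doubled. That word is again reduced, and it is empty only if \<open>w\<close> is.\<close>

lemma double_letters_eq_Nil:
  fixes w :: "nat word"
  assumes "\<And>x. x < 2 \<Longrightarrow> g x = restrict (\<lambda>w. cons_reduce (x, True) (cons_reduce (x, True) w)) reduced_words"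
    and w: "w \<in> carrier (free_group {..<2})"
    and "eval_word (BijGroup reduced_words) g w = \<one>\<^bsub>BijGroup reduced_words\<^esub>"
  shows "w = []"
proof -
  let ?B = "BijGroup reduced_words"
  interpret B: group ?B by (rule group_BijGroup)
  define twice where "twice a w = cons_reduce a (cons_reduce a w)" for a and w :: "nat word"
  have twice_red: "reduced_word (twice a w)" if "reduced_word w" for a w
    using that by (simp add: twice_def reduced_cons_reduce)
  have twice_inv: "twice (x, e) (twice (x, \<not> e) w) = w" if "reduced_word w" for x e w
    using that by (simp add: twice_def cons_reduce_cons_reduce_inv reduced_cons_reduce)
  have letter: "eval_letter ?B g (x, e) = restrict (twice (x, e)) reduced_words" if "x < 2" for x e
  proof -
    have "inv\<^bsub>?B\<^esub> (restrict (twice (x, True)) reduced_words) = restrict (twice (x, False)) reduced_words"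
      using twice_inv[of _ x True] twice_inv[of _ x False] twice_red
      by (intro inv_restrict_BijGroup) auto
    moreover have "g x = restrict (twice (x, True)) reduced_words"
      using assms(1)[OF that] by (simp add: twice_def[abs_def])
    ultimately show ?thesis by (simp add: eval_letter_def)
  qed
  have letter_Bij: "eval_letter ?B g (x, e) \<in> Bij reduced_words" if "x < 2" for x e
    unfolding letter[OF that] using twice_inv[of _ x e] twice_inv[of _ x "\<not> e"] twice_red
    by (intro restrict_Bij[where g = "twice (x, \<not> e)"]) auto
  \<comment> \<open>Membership in \<open>Bij\<close> is carried along because only there products
    are compositions, and reducedness because the letters act on reduced words only.\<close>
  have "eval_word ?B g v \<in> Bij reduced_words \<and>
      eval_word ?B g v [] = concat (map (\<lambda>a. [a, a]) v) \<and>
      reduced_word (concat (map (\<lambda>a. [a, a]) v))"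
    if "reduced_word v" "fst ` set v \<subseteq> {..<2}" for v
    using that
  proof (induction v)
    case Nil
    then show ?case using id_Bij[of reduced_words] by (simp del: restrict_apply) simp
  next
    case (Cons a v)
    obtain x e where a: "a = (x, e)" by (cases a)
    with Cons.prems have x: "x < 2" by simp
    have v: "reduced_word v" "fst ` set v \<subseteq> {..<2}"
      using Cons.prems by (auto dest: reduced_word_ConsD)
    note IH = Cons.IH[OF v]
    let ?d = "concat (map (\<lambda>a. [a, a]) v)"
    have red: "reduced_word (a # a # ?d)"
      using Cons.prems IH by (cases v) (auto simp: inv_letter_def prod_eq_iff)
    then have "twice a ?d = a # a # ?d"
      unfolding twice_def by (subst (2) cons_reduce_reduced) (blast dest: reduced_word_ConsD, rule cons_reduce_reduced)
    moreover have ev: "eval_word ?B g (a # v) = compose reduced_words (eval_letter ?B g a) (eval_word ?B g v)"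
      using letter_Bij[OF x] IH a by simp
    moreover have "eval_word ?B g (a # v) \<in> Bij reduced_words"
      unfolding ev using letter_Bij[OF x] IH a by (intro compose_Bij) auto
    moreover have "compose reduced_words (eval_letter ?B g a) (eval_word ?B g v) [] = twice a ?d"
      using IH letter[OF x] a by (simp add: compose_def)
    ultimately show ?case
      using red by simp
  qed
  from this[of w] w assms(3) have "concat (map (\<lambda>a. [a, a]) w) = []"
    by (auto simp: free_group_def)
  then show ?thesis by (cases w) auto
qed

text \<open>The elements \<open>A\<close> commute with the elements \<open>C\<close>, so evaluating
  both coordinates is a homomorphism on the direct product. One action moves only the
  \<open>A\<close> and its shift only the \<open>C\<close>, which recovers the coordinates
  separately.\<close>

theorem G8_0141_contains_free_square:
  "contains_copy_of (cyclically_presented_group 8 (positive_word 8 [0, 1, 4, 1]))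
     (free_group {..<2::nat} \<times>\<times> free_group {..<2::nat})"
proof -
  let ?P = "cyclic_presentation 8 (positive_word 8 [0, 1, 4, 1])"
  let ?B = "BijGroup reduced_words"
  let ?F = "free_group {..<2::nat}"
  let ?act = "\<lambda>i. restrict (tree_action i) reduced_words"
  interpret P: presentation ?P by (rule presentation_cyclic_positive) simp
  define G where "G = presented_group ?P"
  interpret G: group G unfolding G_def by (rule P.group)
  interpret B: group ?B by (rule group_BijGroup)
  interpret F: group ?F by (rule group_free_group)
  define x where "x = presented_gen ?P"
  have x [simp]: "i < 8 \<Longrightarrow> x i \<in> carrier G" for i
    using P.presented_gen_closed[of i] by (simp add: x_def G_def)
  have rel_word: "positive_word 8 (map (\<lambda>i. i + k) [0, 1, 4, 1]) =
      map (\<lambda>i. (i, True)) [k mod 8, (k + 1) mod 8, (k + 4) mod 8, (k + 1) mod 8]" for k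
    by (simp add: positive_word_def add.commute)
  have rel: "x k \<otimes>\<^bsub>G\<^esub> x ((k + 1) mod 8) \<otimes>\<^bsub>G\<^esub> x ((k + 4) mod 8) \<otimes>\<^bsub>G\<^esub> x ((k + 1) mod 8) = \<one>\<^bsub>G\<^esub>"
    if "k < 8" for k
    using P.eval_relator[OF positive_word_in_rels, of k] that
    unfolding rel_word G_def[symmetric] x_def[symmetric]
    by (simp add: eval_letter_def G.m_assoc)
  \<comment> \<open>All indices other than 0 get the second element, so that closure and commutation
    hold without the bound \<open>i < 2\<close>.\<close>
  define A where "A i = (if i = 0 then x 0 \<otimes>\<^bsub>G\<^esub> inv\<^bsub>G\<^esub> x 4 else x 2 \<otimes>\<^bsub>G\<^esub> inv\<^bsub>G\<^esub> x 6)" for i :: nat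
  define C where "C i = (if i = 0 then inv\<^bsub>G\<^esub> x 5 \<otimes>\<^bsub>G\<^esub> x 1 else inv\<^bsub>G\<^esub> x 7 \<otimes>\<^bsub>G\<^esub> x 3)" for i :: nat
  have [simp]: "A i \<in> carrier G" "C i \<in> carrier G" for i
    by (simp_all add: A_def C_def)
  have AC: "A i \<otimes>\<^bsub>G\<^esub> C j = C j \<otimes>\<^bsub>G\<^esub> A i" for i j
  proof -
    have "(x 0 \<otimes>\<^bsub>G\<^esub> inv\<^bsub>G\<^esub> x 4) \<otimes>\<^bsub>G\<^esub> (inv\<^bsub>G\<^esub> x 5 \<otimes>\<^bsub>G\<^esub> x 1) =
        (inv\<^bsub>G\<^esub> x 5 \<otimes>\<^bsub>G\<^esub> x 1) \<otimes>\<^bsub>G\<^esub> (x 0 \<otimes>\<^bsub>G\<^esub> inv\<^bsub>G\<^esub> x 4)"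
      using rel[of 0] rel[of 4] by (intro G.commute_if_squares_swap_horizontal) simp_all
    moreover have "(x 0 \<otimes>\<^bsub>G\<^esub> inv\<^bsub>G\<^esub> x 4) \<otimes>\<^bsub>G\<^esub> (inv\<^bsub>G\<^esub> x 7 \<otimes>\<^bsub>G\<^esub> x 3) =
        (inv\<^bsub>G\<^esub> x 7 \<otimes>\<^bsub>G\<^esub> x 3) \<otimes>\<^bsub>G\<^esub> (x 0 \<otimes>\<^bsub>G\<^esub> inv\<^bsub>G\<^esub> x 4)"
      using rel[of 7] rel[of 3] by (intro G.commute_if_squares_swap_vertical) simp_all
    moreover have "(x 2 \<otimes>\<^bsub>G\<^esub> inv\<^bsub>G\<^esub> x 6) \<otimes>\<^bsub>G\<^esub> (inv\<^bsub>G\<^esub> x 7 \<otimes>\<^bsub>G\<^esub> x 3) =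
        (inv\<^bsub>G\<^esub> x 7 \<otimes>\<^bsub>G\<^esub> x 3) \<otimes>\<^bsub>G\<^esub> (x 2 \<otimes>\<^bsub>G\<^esub> inv\<^bsub>G\<^esub> x 6)"
      using rel[of 2] rel[of 6] by (intro G.commute_if_squares_swap_horizontal) simp_all
    moreover have "(x 2 \<otimes>\<^bsub>G\<^esub> inv\<^bsub>G\<^esub> x 6) \<otimes>\<^bsub>G\<^esub> (inv\<^bsub>G\<^esub> x 5 \<otimes>\<^bsub>G\<^esub> x 1) =
        (inv\<^bsub>G\<^esub> x 5 \<otimes>\<^bsub>G\<^esub> x 1) \<otimes>\<^bsub>G\<^esub> (x 2 \<otimes>\<^bsub>G\<^esub> inv\<^bsub>G\<^esub> x 6)"
    \<comment> \<open>The relators with \<open>k = 1\<close> and \<open>k = 5\<close> are needed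
      here rotated by two letters.\<close>
    proof (rule G.commute_if_squares_swap_vertical)
      show "x 5 \<otimes>\<^bsub>G\<^esub> x 2 \<otimes>\<^bsub>G\<^esub> x 1 \<otimes>\<^bsub>G\<^esub> x 2 = \<one>\<^bsub>G\<^esub>"
        using rel[of 1] G.inv_comm[of "x 1 \<otimes>\<^bsub>G\<^esub> x 2" "x 5 \<otimes>\<^bsub>G\<^esub> x 2"]
          by (simp add: G.m_assoc del: One_nat_def)
      show "x 1 \<otimes>\<^bsub>G\<^esub> x 6 \<otimes>\<^bsub>G\<^esub> x 5 \<otimes>\<^bsub>G\<^esub> x 6 = \<one>\<^bsub>G\<^esub>"
        using rel[of 5] G.inv_comm[of "x 5 \<otimes>\<^bsub>G\<^esub> x 6" "x 1 \<otimes>\<^bsub>G\<^esub> x 6"] by (simp add: G.m_assoc)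
    qed simp_all
    ultimately show ?thesis
      by (simp add: A_def C_def)
  qed
  have sub [simp]: "f ` S \<subseteq> carrier G" if "\<And>i. f i \<in> carrier G" for f :: "nat \<Rightarrow> nat word set" and S
    using that by auto
  have hom: "eval_word G A \<in> hom ?F G" "eval_word G C \<in> hom ?F G"
    by (simp_all add: G.eval_word_hom)
  have closed [simp]: "eval_word G A w \<in> carrier G" "eval_word G C w \<in> carrier G" for w
    by (simp_all add: G.eval_word_closed)
  have comm: "eval_word G A v \<otimes>\<^bsub>G\<^esub> eval_word G C w = eval_word G C w \<otimes>\<^bsub>G\<^esub> eval_word G A v" for v w
  proof (rule G.eval_word_commute)
    fix i
    show "A i \<otimes>\<^bsub>G\<^esub> eval_word G C w = eval_word G C w \<otimes>\<^bsub>G\<^esub> A i"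
      using G.eval_word_commute[of C w "A i"] AC by simp
  qed simp_all
  define \<Psi> where "\<Psi> = (\<lambda>(v, w). eval_word G A v \<otimes>\<^bsub>G\<^esub> eval_word G C w)"
  have \<Psi>_hom: "\<Psi> \<in> hom (?F \<times>\<times> ?F) G"
  proof (rule homI)
    fix p q assume "p \<in> carrier (?F \<times>\<times> ?F)" "q \<in> carrier (?F \<times>\<times> ?F)"
    then obtain v w v' w' where p: "p = (v, w)" "v \<in> carrier ?F" "w \<in> carrier ?F"
      and q: "q = (v', w')" "v' \<in> carrier ?F" "w' \<in> carrier ?F"
      by auto
    have "eval_word G A v' \<otimes>\<^bsub>G\<^esub> (eval_word G C w \<otimes>\<^bsub>G\<^esub> eval_word G C w') =
        eval_word G C w \<otimes>\<^bsub>G\<^esub> (eval_word G A v' \<otimes>\<^bsub>G\<^esub> eval_word G C w')"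
      using comm[of v' w] by (simp flip: G.m_assoc)
    then show "\<Psi> (p \<otimes>\<^bsub>?F \<times>\<times> ?F\<^esub> q) = \<Psi> p \<otimes>\<^bsub>G\<^esub> \<Psi> q"
      using p q by (simp add: \<Psi>_def hom_mult[OF hom(1)] hom_mult[OF hom(2)] G.m_assoc)
  qed (auto simp: \<Psi>_def)
  interpret \<Psi>: group_hom "?F \<times>\<times> ?F" G \<Psi>
    using \<Psi>_hom DirProd_group[OF F.group_axioms F.group_axioms] G.group_axioms
    by (simp add: group_hom_def group_hom_axioms_def)
  \<comment> \<open>The shift permutes the relators, so the action may be precomposed with it. The
    cases \<open>d = 0\<close> and \<open>d = 7\<close> give the actions on the two trees.\<close>
  have action: "\<exists>h\<in>hom G ?B. \<forall>i<8. h (x i) = ?act ((i + d) mod 8)" for d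
  proof -
    have "eval_word ?B (\<lambda>i. ?act ((i + d) mod 8)) r = \<one>\<^bsub>?B\<^esub>" if r_in: "r \<in> rels ?P" for r
    proof -
      obtain k where r: "r = map (\<lambda>i. (i, True)) [k mod 8, (k + 1) mod 8, (k + 4) mod 8, (k + 1) mod 8]"
        using r_in unfolding rels_cyclic_presentation_positive rel_word by blast
      show ?thesis
        unfolding r
        using tree_action_relator[of "(k + d) mod 8"]
        by (subst eval_positive_BijGroup)
          (auto simp: restrict_tree_action_Bij mod_simps ac_simps intro!: restrict_ext)
    qed
    moreover have "(\<lambda>i. ?act ((i + d) mod 8)) ` gens ?P \<subseteq> carrier ?B"
      by (auto simp: restrict_tree_action_Bij)
    ultimately obtain h where "h \<in> hom (presented_group ?P) ?B"
      "\<And>i. i \<in> gens ?P \<Longrightarrow> h (presented_gen ?P i) = ?act ((i + d) mod 8)"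
      using P.universal[OF B.group_axioms] by blast
    then show ?thesis
      unfolding G_def x_def by (intro bexI[of _ h]) simp_all
  qed
  have trivial: "p = \<one>\<^bsub>?F \<times>\<times> ?F\<^esub>" if p: "p \<in> carrier (?F \<times>\<times> ?F)" "\<Psi> p = \<one>\<^bsub>G\<^esub>" for p
  proof -
    obtain v w where vw: "p = (v, w)" "v \<in> carrier ?F" "w \<in> carrier ?F"
      using p(1) by auto
    obtain h where h: "h \<in> hom G ?B" "\<And>i. i < 8 \<Longrightarrow> h (x i) = ?act (i mod 8)"
      using action[of 0] by auto
    interpret h: group_hom G ?B h
      using h(1) G.group_axioms B.group_axioms by (simp add: group_hom_def group_hom_axioms_def)
    obtain k where k: "k \<in> hom G ?B" "\<And>i. i < 8 \<Longrightarrow> k (x i) = ?act ((i + 7) mod 8)"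
      using action[of 7] by auto
    interpret k: group_hom G ?B k
      using k(1) G.group_axioms B.group_axioms by (simp add: group_hom_def group_hom_axioms_def)
    have one: "eval_word ?B (\<lambda>_. \<one>\<^bsub>?B\<^esub>) u = \<one>\<^bsub>?B\<^esub>" for u :: "nat word"
      by (induction u) (simp_all add: eval_letter_def del: BijGroup_simps)
    have ev: "eval_word ?B (h \<circ> A) v \<otimes>\<^bsub>?B\<^esub> eval_word ?B (h \<circ> C) w = \<one>\<^bsub>?B\<^esub>"
      "eval_word ?B (k \<circ> A) v \<otimes>\<^bsub>?B\<^esub> eval_word ?B (k \<circ> C) w = \<one>\<^bsub>?B\<^esub>"
      using arg_cong[OF p(2), of h] arg_cong[OF p(2), of k]
      by (simp_all add: vw(1) \<Psi>_def G.hom_eval_word[OF B.group_axioms h(1)]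
          G.hom_eval_word[OF B.group_axioms k(1)] del: BijGroup_simps)
    have act: "?act i \<in> carrier ?B" "inv\<^bsub>?B\<^esub> ?act i = restrict (tree_action_inv i) reduced_words"
      if "i < 8" for i
      using that by (simp_all add: restrict_tree_action_Bij inv_tree_action)
    \<comment> \<open>Odd subscripts that differ by 4 act identically; therefore \<open>h\<close>
      kills \<open>C\<close> and, after the shift, \<open>k\<close> kills \<open>A\<close>.\<close>
    have same: "?act 1 = ?act 5" "?act 3 = ?act 7"
      by (simp_all add: tree_action_def)
    \<comment> \<open>Subscripts 0 and 4, like 2 and 6, act as inverse translations, so these
      quotients are squares of translations. This is the source of the doubled letters.\<close>
    have sq: "?act 0 \<otimes>\<^bsub>?B\<^esub> inv\<^bsub>?B\<^esub> ?act 4 = restrict (\<lambda>w. cons_reduce (0, True) (cons_reduce (0, True) w)) reduced_words"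
      "?act 2 \<otimes>\<^bsub>?B\<^esub> inv\<^bsub>?B\<^esub> ?act 6 = restrict (\<lambda>w. cons_reduce (1, True) (cons_reduce (1, True) w)) reduced_words"
      "inv\<^bsub>?B\<^esub> ?act 4 \<otimes>\<^bsub>?B\<^esub> ?act 0 = restrict (\<lambda>w. cons_reduce (0, True) (cons_reduce (0, True) w)) reduced_words"
      "inv\<^bsub>?B\<^esub> ?act 6 \<otimes>\<^bsub>?B\<^esub> ?act 2 = restrict (\<lambda>w. cons_reduce (1, True) (cons_reduce (1, True) w)) reduced_words"
      using act(1)[of 0] act(1)[of 2]
      by (simp_all add: act(2) tree_action_inv_def)
        (simp_all add: tree_action_def compose_def reduced_cons_reduce cong: restrict_cong)
    have "(h \<circ> C) i = \<one>\<^bsub>?B\<^esub>" and "(k \<circ> A) i = \<one>\<^bsub>?B\<^esub>" for i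
      using act(1)[of 1] act(1)[of 3] act(1)[of 5] act(1)[of 7]
      by (simp_all add: C_def A_def h(2) k(2) same del: BijGroup_simps One_nat_def)
    then have hC: "h \<circ> C = (\<lambda>_. \<one>\<^bsub>?B\<^esub>)" and kA: "k \<circ> A = (\<lambda>_. \<one>\<^bsub>?B\<^esub>)"
      by (auto simp: fun_eq_iff)
    have hA: "(h \<circ> A) i = restrict (\<lambda>w. cons_reduce (i, True) (cons_reduce (i, True) w)) reduced_words"
      and kC: "(k \<circ> C) i = restrict (\<lambda>w. cons_reduce (i, True) (cons_reduce (i, True) w)) reduced_words"
      if "i < 2" for i
      using that by (auto simp: less_2_cases_iff A_def C_def h(2) k(2) sq simp del: BijGroup_simps)
    have cl: "eval_word ?B (h \<circ> A) v \<in> carrier ?B" "eval_word ?B (k \<circ> C) w \<in> carrier ?B"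
      by (auto intro!: B.eval_word_closed simp del: BijGroup_simps)
    have "eval_word ?B (h \<circ> A) v = \<one>\<^bsub>?B\<^esub>" "eval_word ?B (k \<circ> C) w = \<one>\<^bsub>?B\<^esub>"
      using ev cl unfolding hC kA one by (simp_all del: BijGroup_simps)
    then have "v = []" "w = []"
      using double_letters_eq_Nil[of "h \<circ> A", OF hA vw(2)] double_letters_eq_Nil[of "k \<circ> C", OF kC vw(3)]
      by blast+
    then show ?thesis
      by (simp add: vw(1) free_group_def)
  qed
  have "inj_on \<Psi> (carrier (?F \<times>\<times> ?F))"
    unfolding \<Psi>.inj_on_one_iff using trivial by blast
  then have "\<Psi> \<in> iso (?F \<times>\<times> ?F) (G\<lparr>carrier := \<Psi> ` carrier (?F \<times>\<times> ?F)\<rparr>)"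
    using \<Psi>_hom by (auto simp: iso_def bij_betw_def hom_def)
  then have "G\<lparr>carrier := \<Psi> ` carrier (?F \<times>\<times> ?F)\<rparr> \<cong> ?F \<times>\<times> ?F"
    using \<Psi>.iso_set_sym is_isoI by blast
  then show ?thesis
    using \<Psi>.img_is_subgroup unfolding contains_copy_of_def cyclically_presented_group_def G_def
    by blast
qed

section \<open>Multigraphs\<close>

lemma mg_walk_verts: "mg_walk \<Gamma> u es v \<Longrightarrow> u \<in> verts \<Gamma> \<and> v \<in> verts \<Gamma>"
  by (induction es arbitrary: u) auto

lemma mg_walk_append:
  "mg_walk \<Gamma> u es v \<Longrightarrow> mg_walk \<Gamma> v fs w \<Longrightarrow> mg_walk \<Gamma> u (es @ fs) w"
  by (induction es arbitrary: u) auto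

lemma verts_component_of: "verts (mg_component_of \<Gamma> u) = {v. \<exists>es. mg_walk \<Gamma> u es v}"
  by (simp add: mg_component_of_def Let_def)

lemma edges_component_of:
  "edges (mg_component_of \<Gamma> u) = {e \<in> edges \<Gamma>. ends \<Gamma> e \<subseteq> verts (mg_component_of \<Gamma> u)}"
  by (simp add: mg_component_of_def Let_def)

lemma ends_component_of [simp]: "ends (mg_component_of \<Gamma> u) = ends \<Gamma>"
  by (simp add: mg_component_of_def Let_def)

lemma walk_component_of: "mg_walk (mg_component_of \<Gamma> u) x es y \<Longrightarrow> mg_walk \<Gamma> x es y"
  by (induction es arbitrary: x)
    (auto simp: verts_component_of edges_component_of dest: mg_walk_verts)

lemma self_in_component_of: "u \<in> verts \<Gamma> \<Longrightarrow> u \<in> verts (mg_component_of \<Gamma> u)"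
  by (auto simp: verts_component_of intro: exI[of _ "[]"])

lemma component_of_step:
  assumes "x \<in> verts (mg_component_of \<Gamma> u)" "e \<in> edges \<Gamma>" "ends \<Gamma> e = {x, y}" "y \<in> verts \<Gamma>"
  shows "y \<in> verts (mg_component_of \<Gamma> u)"
proof -
  obtain es where "mg_walk \<Gamma> u es x"
    using assms(1) by (auto simp: verts_component_of)
  moreover have "mg_walk \<Gamma> x [e] y"
    using mg_walk_verts[OF \<open>mg_walk \<Gamma> u es x\<close>] assms by auto
  ultimately show ?thesis
    unfolding verts_component_of by (blast intro: mg_walk_append)
qed

text \<open>The infimum over no walks would be infinite, so a finite diameter provides a walk; an
  infimum of a nonempty set of \<open>enat\<close> is attained.\<close>

lemma diameter_walk:
  assumes "mg_diameter \<Gamma> = enat m" "u \<in> verts \<Gamma>" "v \<in> verts \<Gamma>"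
  obtains es where "mg_walk \<Gamma> u es v" "length es \<le> m"
proof -
  let ?L = "{enat (length es) | es. mg_walk \<Gamma> u es v}"
  have "mg_dist \<Gamma> u v \<le> enat m"
    unfolding assms(1)[symmetric] mg_diameter_def using assms(2,3) by (intro Sup_upper) auto
  then have le: "Inf ?L \<le> enat m"
    by (simp add: mg_dist_def)
  have "?L \<noteq> {}"
  proof
    assume "?L = {}"
    with le show False by (simp only: Inf_empty) (simp add: top_enat_def)
  qed
  then have "Inf ?L \<in> ?L"
    by (auto simp: Inf_enat_def intro: LeastI)
  with le that show thesis
    by auto
qed

text \<open>A pair of parallel edges is a closed walk of length 2.\<close>

lemma parallel_edges_eq:
  assumes "mg_girth \<Gamma> \<ge> 3" "e \<in> edges \<Gamma>" "e' \<in> edges \<Gamma>" "u \<in> verts \<Gamma>" "v \<in> verts \<Gamma>"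
    "ends \<Gamma> e = {u, v}" "ends \<Gamma> e' = {u, v}"
  shows "e = e'"
proof (rule ccontr)
  assume "e \<noteq> e'"
  moreover have "mg_walk \<Gamma> u [e, e'] u"
    using assms by auto
  ultimately have "mg_girth \<Gamma> \<le> enat (length [e, e'])"
    unfolding mg_girth_def by (intro Inf_lower CollectI exI[of _ u] exI[of _ "[e, e']"]) auto
  with assms(1) have "(3 :: enat) \<le> 2"
    by (metis One_nat_def Suc_1 length_Cons list.size(3) numeral_eq_enat order_trans)
  then show False by simp
qed

text \<open>Injectivity of \<open>ends\<close> excludes parallel edges, so edges correspond to pairs
  in \<open>A\<close> times \<open>B\<close>.\<close>

definition complete_bipartite :: "('v, 'e) multigraph \<Rightarrow> 'v set \<Rightarrow> 'v set \<Rightarrow> bool" where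
  "complete_bipartite \<Gamma> A B \<longleftrightarrow>
     verts \<Gamma> = A \<union> B \<and> A \<inter> B = {} \<and> inj_on (ends \<Gamma>) (edges \<Gamma>) \<and>
     ends \<Gamma> ` edges \<Gamma> = {{a, b} | a b. a \<in> A \<and> b \<in> B}"

section \<open>Diameter, girth and degrees of complete bipartite multigraphs\<close>

context
  fixes \<Gamma> :: "('v, 'e) multigraph" and A B
  assumes cb: "complete_bipartite \<Gamma> A B"
begin

lemma cb_verts: "verts \<Gamma> = A \<union> B" and cb_disjoint: "A \<inter> B = {}"
  and cb_inj: "inj_on (ends \<Gamma>) (edges \<Gamma>)"
  and cb_ends: "ends \<Gamma> ` edges \<Gamma> = {{a, b} | a b. a \<in> A \<and> b \<in> B}"
  using cb by (simp_all add: complete_bipartite_def)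

lemma cb_edge: "a \<in> A \<Longrightarrow> b \<in> B \<Longrightarrow> \<exists>e\<in>edges \<Gamma>. ends \<Gamma> e = {a, b}"
proof -
  assume "a \<in> A" "b \<in> B"
  then have "{a, b} \<in> ends \<Gamma> ` edges \<Gamma>"
    unfolding cb_ends by blast
  then show ?thesis by auto
qed

lemma cb_edgeE:
  assumes "e \<in> edges \<Gamma>"
  obtains a b where "a \<in> A" "b \<in> B" "ends \<Gamma> e = {a, b}"
proof -
  have "ends \<Gamma> e \<in> {{a, b} | a b. a \<in> A \<and> b \<in> B}"
    using assms cb_ends by blast
  with that show thesis by blast
qed

lemma cb_edge_swaps:
  assumes "e \<in> edges \<Gamma>" "ends \<Gamma> e = {u, v}"
  shows "u \<in> A \<longleftrightarrow> v \<notin> A"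
proof -
  obtain a b where "a \<in> A" "b \<in> B" "{u, v} = {a, b}"
    using cb_edgeE[OF assms(1)] assms(2) by metis
  then show ?thesis
    using cb_disjoint by (auto simp: doubleton_eq_iff)
qed

text \<open>Every edge changes sides. This parity yields the lower bounds for the diameter and the
  girth.\<close>

lemma cb_walk_parity: "mg_walk \<Gamma> u es v \<Longrightarrow> (u \<in> A \<longleftrightarrow> v \<in> A) \<longleftrightarrow> even (length es)"
proof (induction es arbitrary: u)
  case (Cons e es)
  then obtain w where "e \<in> edges \<Gamma>" "ends \<Gamma> e = {u, w}" "mg_walk \<Gamma> w es v"
    by auto
  with Cons.IH[of w] cb_edge_swaps[of e u w] show ?case by auto
qed auto

lemma cb_short_walk:
  assumes "A \<noteq> {}" "B \<noteq> {}" "u \<in> verts \<Gamma>" "v \<in> verts \<Gamma>"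
  shows "\<exists>es. mg_walk \<Gamma> u es v \<and> length es \<le> 2"
proof -
  have AB: "\<exists>e. mg_walk \<Gamma> a [e] b \<and> mg_walk \<Gamma> b [e] a" if "a \<in> A" "b \<in> B" for a b
  proof -
    obtain e where "e \<in> edges \<Gamma>" "ends \<Gamma> e = {a, b}"
      using cb_edge[OF \<open>a \<in> A\<close> \<open>b \<in> B\<close>] by blast
    then have "mg_walk \<Gamma> a [e] b \<and> mg_walk \<Gamma> b [e] a"
      using that cb_verts by (auto simp: insert_commute)
    then show ?thesis ..
  qed
  obtain a0 b0 where 0: "a0 \<in> A" "b0 \<in> B"
    using assms by auto
  consider "u \<in> A" "v \<in> B" | "u \<in> B" "v \<in> A" | "u \<in> A" "v \<in> A" | "u \<in> B" "v \<in> B"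
    using assms(3,4) cb_verts by auto
  then show ?thesis
  proof cases
    case 1
    with AB[of u v] obtain e where "mg_walk \<Gamma> u [e] v" by auto
    then show ?thesis by (intro exI[of _ "[e]"]) auto
  next
    case 2
    with AB[of v u] obtain e where "mg_walk \<Gamma> u [e] v" by auto
    then show ?thesis by (intro exI[of _ "[e]"]) auto
  next
    case 3
    with AB[of u b0] AB[of v b0] 0 obtain e e' where "mg_walk \<Gamma> u [e] b0" "mg_walk \<Gamma> b0 [e'] v"
      by auto
    from mg_walk_append[OF this] show ?thesis by (intro exI[of _ "[e] @ [e']"]) auto
  next
    case 4
    with AB[of a0 u] AB[of a0 v] 0 obtain e e' where "mg_walk \<Gamma> u [e] a0" "mg_walk \<Gamma> a0 [e'] v"
      by auto
    from mg_walk_append[OF this] show ?thesis by (intro exI[of _ "[e] @ [e']"]) auto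
  qed
qed

lemma cb_connected: "A \<noteq> {} \<Longrightarrow> B \<noteq> {} \<Longrightarrow> mg_connected \<Gamma>"
  using cb_short_walk cb_verts unfolding mg_connected_def by fast

lemma cb_bipartite: "mg_bipartite \<Gamma>"
  unfolding mg_bipartite_def using cb_verts cb_disjoint by (metis cb_edgeE)

lemma cb_diameter:
  assumes "B \<noteq> {}" "a \<in> A" "a' \<in> A" "a \<noteq> a'"
  shows "mg_diameter \<Gamma> = enat 2"
proof (rule antisym)
  show "mg_diameter \<Gamma> \<le> enat 2"
    unfolding mg_diameter_def
  proof (rule Sup_least)
    fix d assume "d \<in> {mg_dist \<Gamma> u v | u v. u \<in> verts \<Gamma> \<and> v \<in> verts \<Gamma>}"
    then obtain u v where d: "d = mg_dist \<Gamma> u v" and uv: "u \<in> verts \<Gamma>" "v \<in> verts \<Gamma>"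
      by auto
    from assms have "A \<noteq> {}" by auto
    from cb_short_walk[OF this assms(1) uv] obtain es where "mg_walk \<Gamma> u es v" "length es \<le> 2"
      by auto
    then have "d \<le> enat (length es)"
      unfolding d mg_dist_def by (intro Inf_lower) auto
    with \<open>length es \<le> 2\<close> show "d \<le> enat 2"
      by (meson enat_ord_simps(1) order_trans)
  qed
next
  have "enat 2 \<le> mg_dist \<Gamma> a a'"
    unfolding mg_dist_def
  proof (rule Inf_greatest)
    fix l assume "l \<in> {enat (length es) | es. mg_walk \<Gamma> a es a'}"
    then obtain es where l: "l = enat (length es)" and walk: "mg_walk \<Gamma> a es a'"
      by auto
    have "even (length es)" "es \<noteq> []"
      using cb_walk_parity[OF walk] walk assms by auto
    \<comment> \<open>The case rule of \<open>remdups_adj\<close> separates lists of length 0, of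
      length 1 and of length at least 2.\<close>
    then have "length es \<ge> 2"
      by (cases es rule: remdups_adj.cases) auto
    then show "enat 2 \<le> l"
      by (simp add: l)
  qed
  also have "\<dots> \<le> mg_diameter \<Gamma>"
    unfolding mg_diameter_def using assms cb_verts by (intro Sup_upper) auto
  finally show "enat 2 \<le> mg_diameter \<Gamma>" .
qed

text \<open>Two vertices on each side span a closed walk of length 4. Closed walks have even length,
  and two different edges forming one of length 2 would have equal ends.\<close>

lemma cb_girth:
  assumes "a \<in> A" "a' \<in> A" "a \<noteq> a'" "b \<in> B" "b' \<in> B" "b \<noteq> b'"
  shows "mg_girth \<Gamma> = enat 4"
proof (rule antisym)
  obtain e1 e2 e3 e4 where e: "e1 \<in> edges \<Gamma>" "ends \<Gamma> e1 = {a, b}" "e2 \<in> edges \<Gamma>" "ends \<Gamma> e2 = {a', b}"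
    "e3 \<in> edges \<Gamma>" "ends \<Gamma> e3 = {a', b'}" "e4 \<in> edges \<Gamma>" "ends \<Gamma> e4 = {a, b'}"
    using cb_edge assms by metis
  have "mg_walk \<Gamma> a [e1, e2, e3, e4] a"
    using e assms cb_verts by (auto simp: insert_commute)
  moreover have "e1 \<noteq> e2" "e2 \<noteq> e3" "e3 \<noteq> e4"
    using e assms cb_disjoint by (auto simp: doubleton_eq_iff)
  ultimately have "mg_girth \<Gamma> \<le> enat (length [e1, e2, e3, e4])"
    unfolding mg_girth_def by (intro Inf_lower CollectI exI[of _ a] exI[of _ "[e1, e2, e3, e4]"]) auto
  then show "mg_girth \<Gamma> \<le> enat 4"
    by (simp add: eval_nat_numeral)
next
  show "enat 4 \<le> mg_girth \<Gamma>"
    unfolding mg_girth_def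
  proof (rule Inf_greatest)
    fix l assume "l \<in> {enat (length es) | u es. es \<noteq> [] \<and> mg_walk \<Gamma> u es u \<and> distinct_adj es}"
    then obtain u es where l: "l = enat (length es)" and es: "es \<noteq> []" "mg_walk \<Gamma> u es u" "distinct_adj es"
      by auto
    have "even (length es)"
      using cb_walk_parity[OF es(2)] by simp
    moreover have "length es \<noteq> 2"
    proof
      assume "length es = 2"
      then obtain e e' where "es = [e, e']"
        by (auto simp: length_Suc_conv eval_nat_numeral)
      with es have "ends \<Gamma> e = ends \<Gamma> e'" "e \<in> edges \<Gamma>" "e' \<in> edges \<Gamma>" "e \<noteq> e'"
        by (auto simp: insert_commute)
      with cb_inj show False by (auto dest: inj_onD)
    qed
    moreover have "length es \<noteq> 0"
      using es by simp
    ultimately have "length es \<ge> 4"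
      by presburger
    then show "enat 4 \<le> l"
      by (simp add: l)
  qed
qed

lemma cb_degree_aux:
  assumes "finite U" "v \<notin> U" "\<And>u. u \<in> U \<Longrightarrow> \<exists>e\<in>edges \<Gamma>. ends \<Gamma> e = {v, u}"
    "finite (edges \<Gamma>)"
  shows "card U \<le> mg_degree \<Gamma> v"
proof -
  let ?E = "{e \<in> edges \<Gamma>. v \<in> ends \<Gamma> e}"
  have "(\<lambda>u. {v, u}) ` U \<subseteq> ends \<Gamma> ` ?E"
    using assms(3) by force
  moreover have "card ((\<lambda>u. {v, u}) ` U) = card U"
    by (intro card_image inj_onI) (auto simp: doubleton_eq_iff)
  moreover have "card (ends \<Gamma> ` ?E) \<le> card ?E"
    using assms(4) by (intro card_image_le) simp
  moreover have "finite (ends \<Gamma> ` ?E)"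
    using assms(4) by simp
  ultimately have "card U \<le> card ?E"
    by (metis card_mono order_trans)
  then show ?thesis
    by (simp add: mg_degree_def)
qed

lemma cb_degree:
  assumes "finite A" "finite B" "finite (edges \<Gamma>)" "v \<in> verts \<Gamma>"
  shows "min (card A) (card B) \<le> mg_degree \<Gamma> v"
proof (cases "v \<in> A")
  case True
  have "card B \<le> mg_degree \<Gamma> v"
    using True cb_disjoint assms by (intro cb_degree_aux) (auto intro: cb_edge)
  then show ?thesis by simp
next
  case False
  then have "v \<in> B" using assms cb_verts by auto
  then have "card A \<le> mg_degree \<Gamma> v"
    using cb_disjoint assms
    by (intro cb_degree_aux) (auto simp: insert_commute[of v] intro: cb_edge)
  then show ?thesis by simp
qed

end

text \<open>The two bijections combine to a map of vertices. An edge is determined by its ends, so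
  this map also dictates the map of edges.\<close>

lemma cb_isomorphic:
  assumes "complete_bipartite \<Gamma> A B" "complete_bipartite \<Delta> A' B'"
    and "bij_betw f A A'" "bij_betw h B B'"
  shows "mg_isomorphic \<Gamma> \<Delta>"
proof -
  note cb = assms(1)[unfolded complete_bipartite_def] assms(2)[unfolded complete_bipartite_def]
  define \<phi> where "\<phi> v = (if v \<in> A then f v else h v)" for v
  have \<phi>A: "bij_betw \<phi> A A'" and \<phi>B: "bij_betw \<phi> B B'"
    using assms(3,4) cb by (auto simp: \<phi>_def cong: bij_betw_cong)
      (subst bij_betw_cong[where g = h]; auto)
  have \<phi>: "bij_betw \<phi> (verts \<Gamma>) (verts \<Delta>)"
    using bij_betw_combine[OF \<phi>A \<phi>B] cb by simp
  let ?E = "{{a, b} | a b. a \<in> A \<and> b \<in> B}"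
  let ?E' = "{{a, b} | a b. a \<in> A' \<and> b \<in> B'}"
  have "inj_on (image \<phi>) ?E"
    by (rule inj_on_subset[OF inj_on_image_Pow[OF bij_betw_imp_inj_on[OF \<phi>]]]) (use cb in auto)
  moreover have "image \<phi> ` ?E = ?E'"
  proof -
    have "image \<phi> ` ?E = {{\<phi> a, \<phi> b} | a b. a \<in> A \<and> b \<in> B}"
      by (auto intro!: image_eqI[where x = "{_, _}"])
    also have "\<dots> = {{a, b} | a b. a \<in> \<phi> ` A \<and> b \<in> \<phi> ` B}"
      by auto
    finally show ?thesis
      using \<phi>A \<phi>B by (simp add: bij_betw_def)
  qed
  ultimately have "bij_betw (image \<phi>) ?E ?E'"
    by (simp add: bij_betw_def)
  moreover have \<Gamma>: "bij_betw (ends \<Gamma>) (edges \<Gamma>) ?E" and \<Delta>: "bij_betw (ends \<Delta>) (edges \<Delta>) ?E'"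
    using cb by (simp_all add: bij_betw_def)
  ultimately have im: "bij_betw (image \<phi> \<circ> ends \<Gamma>) (edges \<Gamma>) ?E'"
    using bij_betw_trans by blast
  then have "bij_betw (inv_into (edges \<Delta>) (ends \<Delta>) \<circ> (image \<phi> \<circ> ends \<Gamma>)) (edges \<Gamma>) (edges \<Delta>)"
    using bij_betw_inv_into[OF \<Delta>] bij_betw_trans by blast
  moreover have "ends \<Delta> ((inv_into (edges \<Delta>) (ends \<Delta>) \<circ> (image \<phi> \<circ> ends \<Gamma>)) e) = \<phi> ` ends \<Gamma> e"
    if "e \<in> edges \<Gamma>" for e
    using bij_betw_inv_into_right[OF \<Delta>] bij_betwE[OF im] that by simp
  ultimately show ?thesis
    unfolding mg_isomorphic_def using \<phi> by blast
qed

section \<open>The star graph of a positive cyclic presentation of length 4\<close>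

lemma inv_word_inv_word [simp]: "inv_word (inv_word w) = w"
  by (simp add: inv_word_def rev_map comp_def)

lemma rotate_inv_word: "\<exists>l. rotate k (inv_word w) = inv_word (rotate l w)"
  by (simp add: inv_word_def rotate_rev rotate_map flip: rev_map) blast

text \<open>The relators are the words \<open>x\<^sub>k x\<^bsub>k+q 0\<^esub> x\<^bsub>k+q 0+q 1\<^esub> x\<^bsub>k+q 0+q 1+q 2\<^esub>\<close>; the last increment
  \<open>q 3\<close> closes up the cyclic word.\<close>

locale cyclic_square =
  fixes n :: nat and q :: "nat \<Rightarrow> nat"
  assumes n_pos: "n > 0" and q_less: "q j < n" and q_period: "q (j + 4) = q j"
    and q_sum: "(q 0 + q 1 + q 2 + q 3) mod n = 0"
begin

text \<open>A cyclic permutation of a relator: \<open>j\<close> counts the letters moved to the end,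
  and \<open>k\<close> is the subscript of the letter now in front. With arbitrary natural
  \<open>k\<close> and \<open>j\<close>, rotation acts by addition on both.\<close>

definition square :: "nat \<Rightarrow> nat \<Rightarrow> nat word" where
  "square k j = positive_word n [k, k + q j, k + q j + q (j + 1), k + q j + q (j + 1) + q (j + 2)]"

abbreviation "P \<equiv> cyclic_presentation n (square 0 0)"

lemma q_sum_shift: "(q j + q (j + 1) + q (j + 2) + q (j + 3)) mod n = 0"
proof (induction j)
  case 0
  then show ?case using q_sum by (simp add: numeral_2_eq_2 numeral_3_eq_3)
next
  case (Suc j)
  have "q (Suc j) + q (Suc j + 1) + q (Suc j + 2) + q (Suc j + 3) =
      q j + q (j + 1) + q (j + 2) + q (j + 3)"
    using q_period[of j] by (simp add: numeral_eq_Suc)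
  with Suc show ?case
    by (simp only:)
qed

lemma add_mod_left: "s mod n = 0 \<Longrightarrow> (k + s) mod n = k mod n"
  by (metis add.right_neutral mod_add_right_eq)

lemma q_mod: "q (j mod 4) = q j"
proof (induction j rule: less_induct)
  case (less j)
  show ?case
  proof (cases "j < 4")
    case False
    then have "q ((j - 4) mod 4) = q (j - 4)"
      using less by simp
    then show ?thesis
      using q_period[of "j - 4"] False by (simp add: le_mod_geq)
  qed simp
qed

lemma square_mod: "square (k mod n) j = square k j"
  by (simp add: square_def positive_word_def mod_simps add.assoc)

lemma square_mod4: "square k (j mod 4) = square k j"
  using q_mod[of j] q_mod[of "j + 1"] q_mod[of "j + 2"] q_mod[of "j mod 4 + 1"] q_mod[of "j mod 4 + 2"]
  by (simp add: square_def mod_simps)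

lemma rotate1_square: "rotate1 (square k j) = square (k + q j) (j + 1)"
proof -
  have "(k + q j + q (j + 1) + q (j + 2) + q (j + 3)) mod n = k mod n"
    using add_mod_left[OF q_sum_shift[of j], of k]
    by (simp add: add.assoc)
  then show ?thesis
    by (simp add: square_def positive_word_def numeral_3_eq_3 numeral_2_eq_2)
qed

lemma rotate_square: "rotate m (square k j) = square (k + (\<Sum>i<m. q (j + i))) (j + m)"
proof (induction m)
  case (Suc m)
  then show ?case
    by (simp only: rotate_Suc rotate1_square) (simp add: add.assoc)
qed simp

lemma rels_P: "rels P = {square k 0 | k. k < n}"
  unfolding square_def rels_cyclic_presentation_positive
  by (simp add: add.commute add.left_commute)

lemma rels_P': "square k 0 \<in> rels P"
  unfolding rels_P using n_pos by (auto intro!: exI[of _ "k mod n"] simp: square_mod)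

lemma rotations_P: "{rotate m r | m r. r \<in> rels P} = {square k j | k j. True}"
proof (intro equalityI subsetI)
  fix w assume "w \<in> {rotate m r | m r. r \<in> rels P}"
  then obtain m k where "w = square (k + (\<Sum>i<m. q (0 + i))) (0 + m)"
    unfolding rels_P using rotate_square by blast
  then show "w \<in> {square k j | k j. True}"
    by blast
next
  fix w assume "w \<in> {square k j | k j. True}"
  then obtain k j where w: "w = square k j" by auto
  \<comment> \<open>The relator must start \<open>s\<close> before \<open>k\<close>;
    \<open>(n - 1) * s\<close> replaces \<open>-s\<close>.\<close>
  define s where "s = (\<Sum>i<j. q i)"
  have s: "k + (n - 1) * s + s = k + n * s"
    using n_pos by (cases n) auto
  have "rotate j (square (k + (n - 1) * s) 0) = square (k + (n - 1) * s + s) j"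
    by (simp add: rotate_square s_def)
  also have "\<dots> = square (k + n * s) j"
    by (simp only: s)
  also have "\<dots> = w"
    using square_mod[of "k + n * s" j] square_mod[of k j] by (simp add: w)
  finally show "w \<in> {rotate m r | m r. r \<in> rels P}"
    using rels_P' by blast
qed

lemma symmetrized_P:
  "w \<in> symmetrized_relators P \<longleftrightarrow> (\<exists>k j. w = square k j \<or> w = inv_word (square k j))"
proof
  assume "w \<in> symmetrized_relators P"
  then obtain m r where w: "w = rotate m r \<or> w = rotate m (inv_word r)" and r: "r \<in> rels P"
    by (auto simp: symmetrized_relators_def)
  then obtain l where l: "w = rotate l r \<or> w = inv_word (rotate l r)"
    using rotate_inv_word[of m r] by metis
  have "rotate l r \<in> {square k j | k j. True}"
    using r unfolding rotations_P[symmetric] by blast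
  then obtain k j where "rotate l r = square k j"
    by blast
  with l show "\<exists>k j. w = square k j \<or> w = inv_word (square k j)"
    by (intro exI[of _ k] exI[of _ j]) simp
next
  assume "\<exists>k j. w = square k j \<or> w = inv_word (square k j)"
  then obtain k j where w: "w = square k j \<or> w = inv_word (square k j)"
    by blast
  have "square k j \<in> {rotate m r | m r. r \<in> rels P}"
    unfolding rotations_P by auto
  then obtain m r where r: "r \<in> rels P" "square k j = rotate m r"
    by auto
  obtain l where "rotate m (inv_word (inv_word r)) = inv_word (rotate l (inv_word r))"
    using rotate_inv_word by blast
  then have l: "inv_word (rotate m r) = rotate l (inv_word r)"
    by simp
  from w show "w \<in> symmetrized_relators P"
    unfolding symmetrized_relators_def r(2) l using r(1) by blast
qed

abbreviation edge :: "nat \<Rightarrow> nat \<Rightarrow> nat word set" where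
  "edge k j \<equiv> {square k j, star_partner (square k j)}"

text \<open>For length 4 the partner is the inverse of the rotation by two letters; in particular
  the partner of a positive word is negative.\<close>

lemma star_partner_square:
  "star_partner (square k j) = inv_word (square (k + q j + q (j + 1)) (j + 2))"
proof -
  have "rotate 2 (square k j) = square (k + q j + q (j + 1)) (j + 2)"
    by (simp add: rotate_square numeral_2_eq_2 add.assoc)
  moreover have "star_partner (square k j) = inv_word (rotate 2 (square k j))"
    by (simp add: square_def positive_word_def inv_word_def numeral_2_eq_2)
  ultimately show ?thesis by simp
qed

lemma star_partner_inv_square:
  "star_partner (inv_word (square k j)) = square (k + q j + q (j + 1)) (j + 2)"
proof -
  have "rotate 2 (square k j) = square (k + q j + q (j + 1)) (j + 2)"
    by (simp add: rotate_square numeral_2_eq_2 add.assoc)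
  moreover have "star_partner (inv_word (square k j)) = rotate 2 (square k j)"
    by (simp add: square_def positive_word_def inv_word_def numeral_2_eq_2)
  ultimately show ?thesis by simp
qed

lemma length_square [simp]: "length (square k j) = 4"
  by (simp add: square_def positive_word_def)

text \<open>Each edge consists of a positive and a negative word and is parametrized by the positive
  one.\<close>

lemma edges_star: "edges (star_graph P) = range (\<lambda>(k, j). edge k j)"
proof (intro equalityI subsetI)
  fix E assume "E \<in> edges (star_graph P)"
  then obtain w where E: "E = {w, star_partner w}" and "w \<in> symmetrized_relators P"
    by (auto simp: star_graph_def)
  then obtain k j where "w = square k j \<or> w = inv_word (square k j)"
    unfolding symmetrized_P by blast
  then show "E \<in> range (\<lambda>(k, j). edge k j)"
  proof
    \<comment> \<open>The positive word is now the partner of \<open>w\<close>. Its own partner is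
      \<open>w\<close> again, because four increments sum to 0 modulo \<open>n\<close>.\<close>
    assume w: "w = inv_word (square k j)"
    define k' where "k' = k + q j + q (j + 1)"
    define k'' where "k'' = k' + q (j + 2) + q (j + 3)"
    have "star_partner (square k' (j + 2)) = inv_word (square k'' (j + 4))"
      using star_partner_square[of k' "j + 2"] by (simp add: k''_def numeral_eq_Suc)
    also have "square k'' (j + 4) = square k j"
    proof -
      have "k'' mod n = k mod n"
        using add_mod_left[OF q_sum_shift[of j], of k]
        by (simp add: add.assoc k''_def k'_def)
      then show ?thesis
        using square_mod[of k'' "j + 4"] square_mod[of k "j + 4"]
          square_mod4[of k "j + 4"] square_mod4[of k j] by simp
    qed
    finally have "E = edge k' (j + 2)"
      unfolding E w star_partner_inv_square k'_def[symmetric] by auto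
    then show ?thesis by auto
  qed (use E in auto)
next
  fix E assume "E \<in> range (\<lambda>(k, j). edge k j)"
  then obtain k j where E: "E = edge k j"
    by auto
  have "square k j \<in> symmetrized_relators P"
    unfolding symmetrized_P by blast
  then show "E \<in> edges (star_graph P)"
    unfolding star_graph_def E using length_square[of k j]
    by (intro CollectI exI[of _ "square k j"] conjI | simp)+
qed

lemma edge_in: "edge k j \<in> edges (star_graph P)"
  unfolding edges_star by auto

lemma edgeE:
  assumes "e \<in> edges (star_graph P)"
  obtains k j where "k < n" "j < 4" "e = edge k j"
proof -
  obtain k j where "e = edge k j"
    using assms unfolding edges_star by auto
  then have "e = edge (k mod n) (j mod 4)"
    by (simp only: square_mod square_mod4)
  then show thesis
    using that[of "k mod n" "j mod 4"] n_pos by simp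
qed

lemma finite_edges_star: "finite (edges (star_graph P))"
proof (rule finite_subset)
  show "edges (star_graph P) \<subseteq> (\<lambda>(k, j). edge k j) ` ({..<n} \<times> {..<4})"
    by (auto elim!: edgeE)
qed simp

lemma verts_star: "verts (star_graph P) = {..<n} \<times> UNIV"
  by (simp add: star_graph_def)

lemma ends_edge: "ends (star_graph P) (edge k j) = {(k mod n, True), ((k + q j) mod n, False)}"
  by (simp add: star_graph_def square_def positive_word_def inv_letter_def)

lemma edge_eq_iff: "edge k j = edge k' j' \<longleftrightarrow> square k j = square k' j'"
proof
  assume eq: "edge k j = edge k' j'"
  have "snd (hd (square k j)) = True" "snd (hd (star_partner (square k' j'))) = False"
    by (simp_all add: square_def positive_word_def inv_letter_def)
  then have "square k j \<noteq> star_partner (square k' j')"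
    by metis
  with eq show "square k j = square k' j'"
    by blast
qed simp

text \<open>Differences of consecutive subscripts recover the increments, which are residues below
  \<open>n\<close>.\<close>

lemma square_eq_imp:
  assumes "square k i = square k j"
  shows "q i = q j" "q (i + 1) = q (j + 1)" "q (i + 2) = q (j + 2)"
proof -
  have cancel: "b = d" if "(a + b) mod n = (a + d) mod n" "b < n" "d < n" for a b d
    using that cong_add_lcancel_nat[of a b d n] by (simp add: cong_def)
  show 0: "q i = q j"
    using assms q_less by (auto simp: square_def positive_word_def intro: cancel[of k])
  then show 1: "q (i + 1) = q (j + 1)"
    using assms q_less by (auto simp: square_def positive_word_def intro: cancel[of "k + q j"])
  show "q (i + 2) = q (j + 2)"
    using assms q_less 0 1
    by (auto simp: square_def positive_word_def intro: cancel[of "k + q j + q (Suc j)"])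
qed

lemma square_cong:
  "q i = q j \<Longrightarrow> q (i + 1) = q (j + 1) \<Longrightarrow> q (i + 2) = q (j + 2) \<Longrightarrow> square k i = square k j"
  by (simp add: square_def)

end

section \<open>Special presentations of length 4\<close>

lemma sum_endo_inj:
  "finite S \<Longrightarrow> f ` S \<subseteq> S \<Longrightarrow> inj_on f S \<Longrightarrow> sum f S = \<Sum>S"
  using sum.reindex[of f S "\<lambda>x. x"] endo_inj_surj[of S f] by simp

lemma add_diff_mod_inj:
  fixes a :: nat
  assumes "(a + (n - b)) mod n = (a + (n - c)) mod n" "b < n" "c < n"
  shows "b = c"
proof -
  have "[n - b = n - c] (mod n)"
    using assms(1) by (simp add: cong_add_lcancel_nat flip: cong_def)
  then have "[n - b + (b + c) = n - c + (b + c)] (mod n)"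
    by (rule cong_add) simp
  moreover have "n - b + (b + c) = n + c" "n - c + (b + c) = n + b"
    using assms by simp_all
  ultimately have "c mod n = b mod n"
    by (simp add: cong_def)
  with assms show ?thesis by simp
qed

text \<open>If \<open>S\<close> is a coset of a subgroup of \<open>\<int>/n\<close>, then \<open>b \<mapsto> 2a - b\<close> and \<open>b \<mapsto> b + a - c\<close> permute \<open>S\<close>;
  compare the sums over \<open>S\<close> and its image.\<close>

lemma zero_sum_coset:
  fixes S :: "nat set"
  assumes S: "S \<subseteq> {..<n}" "n > 0"
    and closed: "\<And>a b c. a \<in> S \<Longrightarrow> b \<in> S \<Longrightarrow> c \<in> S \<Longrightarrow> (a + b + (n - c)) mod n \<in> S"
    and sum: "n dvd \<Sum>S" and a: "a \<in> S"
  shows "n dvd 2 * card S * a"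
    and "c \<in> S \<Longrightarrow> n dvd card S * (a + (n - c))"
proof -
  have fin: "finite S" using S(1) finite_subset by blast
  have "n dvd (\<Sum>b\<in>S. 2 * a + (n - b))"
  proof -
    have "(\<Sum>b\<in>S. (2 * a + (n - b)) mod n) = \<Sum>S"
      using closed[OF a a] S a
      by (intro sum_endo_inj fin) (auto simp: mult_2 intro!: inj_onI dest!: add_diff_mod_inj)
    with sum show ?thesis
      using mod_sum_eq[of "\<lambda>b. 2 * a + (n - b)" n S] by (simp add: dvd_eq_mod_eq_0)
  qed
  \<comment> \<open>Adding the sum of \<open>S\<close> turns each summand
    \<open>2 * a + (n - b)\<close> into the constant \<open>2 * a + n\<close>.\<close>
  with sum have "n dvd (\<Sum>b\<in>S. 2 * a + (n - b)) + \<Sum>S"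
    by (simp add: dvd_add)
  also have "\<dots> = (\<Sum>b\<in>S. 2 * a + n)"
    unfolding sum.distrib[symmetric] using S by (intro sum.cong) auto
  also have "\<dots> = 2 * card S * a + n * card S"
    by (simp add: algebra_simps)
  finally show "n dvd 2 * card S * a"
    by (simp add: dvd_add_left_iff)
  assume c: "c \<in> S"
  have "n dvd (\<Sum>b\<in>S. b + (a + (n - c)))"
  proof -
    have "(\<Sum>b\<in>S. (b + (a + (n - c))) mod n) = \<Sum>S"
    proof (intro sum_endo_inj fin)
      show "(\<lambda>b. (b + (a + (n - c))) mod n) ` S \<subseteq> S"
        using closed[OF _ a c] by (auto simp: add.assoc)
      show "inj_on (\<lambda>b. (b + (a + (n - c))) mod n) S"
      proof (rule inj_onI)
        fix b d assume bd: "b \<in> S" "d \<in> S" "(b + (a + (n - c))) mod n = (d + (a + (n - c))) mod n"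
        then have "[b = d] (mod n)"
          by (simp add: cong_add_rcancel_nat flip: cong_def)
        moreover have "b < n" "d < n"
          using bd S by auto
        ultimately show "b = d"
          by (simp add: cong_def)
      qed
    qed
    with sum show ?thesis
      using mod_sum_eq[of "\<lambda>b. b + (a + (n - c))" n S] by (simp add: dvd_eq_mod_eq_0)
  qed
  then have "n dvd \<Sum>S + card S * (a + (n - c))"
    by (simp add: sum.distrib)
  with sum show "n dvd card S * (a + (n - c))"
    by (simp add: dvd_add_right_iff)
qed

section \<open>Necessity: what a special presentation forces on the increments\<close>

context cyclic_square
begin

lemma zero_vert: "(0, True) \<in> verts (star_graph P)"
  using n_pos by (simp add: verts_star)

context
  fixes \<nu>
  assumes special: "special_presentation 2 4 \<nu> P"
begin

abbreviation (input) "C \<equiv> mg_component_of (star_graph P) (0, True)"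

lemma special_component:
  "mg_diameter C = enat 2" "mg_girth C = enat 4" "v \<in> verts C \<Longrightarrow> mg_degree C v \<ge> 3"
proof -
  have "C \<in> mg_components (star_graph P)"
    unfolding mg_components_def using zero_vert by blast
  with special show "mg_diameter C = enat 2" "mg_girth C = enat 4"
    "v \<in> verts C \<Longrightarrow> mg_degree C v \<ge> 3"
    unfolding special_presentation_def by auto
qed

lemma target_in_component: "(k mod n, True) \<in> verts C \<longleftrightarrow> ((k + q j) mod n, False) \<in> verts C"
proof -
  have "(k mod n, True) \<in> verts (star_graph P)" "((k + q j) mod n, False) \<in> verts (star_graph P)"
    using n_pos by (simp_all add: verts_star)
  then show ?thesis
    using component_of_step[OF _ edge_in[of k j], of "(k mod n, True)" "(0, True)" "((k + q j) mod n, False)"]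
      component_of_step[OF _ edge_in[of k j], of "((k + q j) mod n, False)" "(0, True)" "(k mod n, True)"]
      ends_edge[of k j]
    by (auto simp: insert_commute)
qed

text \<open>The two words give edges with the same ends at \<open>(0, True)\<close>; girth 4 makes
  them the same edge, hence the same word.\<close>

lemma parallel_squares_eq:
  assumes "q i = q j"
  shows "square 0 i = square 0 j"
proof -
  have 0: "(0, True) \<in> verts C"
    by (rule self_in_component_of[OF zero_vert])
  have q: "(q i, False) \<in> verts C"
    using target_in_component[of 0 i] 0 q_less[of i] by simp
  have "edge 0 i = edge 0 j"
  proof (rule parallel_edges_eq)
    show "3 \<le> mg_girth C"
      using special_component(2) by (simp add: numeral_eq_enat)
    show "edge 0 i \<in> edges C" "edge 0 j \<in> edges C"
      using 0 q assms q_less by (simp_all add: edges_component_of edge_in ends_edge)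
    show "ends C (edge 0 i) = {(0, True), (q i, False)}" "ends C (edge 0 j) = {(0, True), (q i, False)}"
      using assms q_less by (simp_all add: ends_edge)
  qed fact+
  then show ?thesis
    by (simp add: edge_eq_iff)
qed

text \<open>If two increments agree, the whole words agree by \<open>parallel_squares_eq\<close>, so
  the equality propagates and \<open>q\<close> has period 1, 2 or 3. With period 4 this gives period
  2, leaving at most two edges at \<open>(0, True)\<close>, against degree at least 3.\<close>

lemma special_inj: "inj_on q {..<4}"
proof (rule ccontr)
  assume "\<not> inj_on q {..<4}"
  then obtain i j where "i < 4" "j < 4" "i \<noteq> j" "q i = q j"
    by (auto simp: inj_on_def)
  then obtain i j where ij: "i < j" "j < 4" "q i = q j"
    by (metis linorder_neqE_nat)
  define d where "d = j - i"
  have shift: "q (i + m) = q (j + m)" for m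
  proof (induction m)
    case (Suc m)
    then show ?case
      using square_eq_imp(2)[OF parallel_squares_eq[of "i + m" "j + m"]] by simp
  qed (use ij in simp)
  have period: "q (t + 4 * m) = q t" for t m
    using q_mod[of "t + 4 * m"] q_mod[of t] by simp
  have d: "q (t + d) = q t" for t
  proof -
    \<comment> \<open>\<open>3 * i\<close> plays the role of \<open>-i\<close> modulo the period
      4.\<close>
    have "i + (t + 3 * i) = t + 4 * i" "j + (t + 3 * i) = (t + d) + 4 * i"
      using ij by (simp_all add: d_def)
    then show ?thesis
      using shift[of "t + 3 * i"] period by metis
  qed
  have two: "q (t + 2) = q t" for t
  proof -
    have "d = 1 \<or> d = 2 \<or> d = 3"
      using ij by (auto simp: d_def)
    moreover have "q (t + d + d) = q t"
      using d by simp
    moreover have "q (t + 2 + 4) = q (t + 2)"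
      by (rule q_period)
    \<comment> \<open>For \<open>d = 3\<close>, two steps make 6, which is 2 up to the period
      4.\<close>
    moreover have "t + 2 + 4 = t + 3 + 3" "t + 2 = t + 1 + 1"
      by simp_all
    ultimately show ?thesis
      using d[of t] by metis
  qed
  have sq: "square 0 (t + 2) = square 0 t" for t
    using two[of t] two[of "t + 1"] two[of "t + 2"] by (intro square_cong) (simp_all add: ac_simps)
  have "edge 0 2 = edge 0 0" "edge 0 3 = edge 0 1"
    unfolding edge_eq_iff using sq[of 0] sq[of 1] by (simp_all del: One_nat_def add_2_eq_Suc')
  then have four: "edge 0 j \<in> {edge 0 0, edge 0 1}" if "j < 4" for j
  proof -
    have "j \<in> {0, 1, 2, 3}"
      using that by auto
    then show ?thesis
      using \<open>edge 0 2 = edge 0 0\<close> \<open>edge 0 3 = edge 0 1\<close> by (elim insertE emptyE) simp_all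
  qed
  have "{e \<in> edges C. (0, True) \<in> ends C e} \<subseteq> {edge 0 0, edge 0 1}"
  proof
    fix e assume "e \<in> {e \<in> edges C. (0, True) \<in> ends C e}"
    then have e: "e \<in> edges (star_graph P)" "(0, True) \<in> ends (star_graph P) e"
      by (auto simp: edges_component_of)
    obtain k j where kj: "k < n" "j < 4" "e = edge k j"
      using edgeE[OF e(1)] .
    with e(2) have "k = 0"
      unfolding kj(3) ends_edge by simp
    then show "e \<in> {edge 0 0, edge 0 1}"
      using four[OF kj(2)] kj(3) by simp
  qed
  then have "card {e \<in> edges C. (0, True) \<in> ends C e} \<le> card {edge 0 0, edge 0 1}"
    by (intro card_mono) auto
  also have "\<dots> \<le> 2"
    by (simp add: card_insert_if)
  finally have "card {e \<in> edges C. (0, True) \<in> ends C e} \<le> 2" .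
  \<comment> \<open>The ends of an edge have different signs, so no loop contributes to the
    degree.\<close>
  moreover have "{e \<in> edges C. ends C e = {(0, True)}} = {}"
  proof -
    have "ends C e \<noteq> {(0, True)}" if "e \<in> edges C" for e
    proof -
      have "e \<in> edges (star_graph P)"
        using that by (simp add: edges_component_of)
      then obtain k j where "e = edge k j"
        by (rule edgeE)
      then have "ends C e = {(k mod n, True), ((k + q j) mod n, False)}"
        by (simp only: ends_component_of ends_edge)
      then show ?thesis
        by auto
    qed
    then show ?thesis by blast
  qed
  ultimately have "mg_degree C (0, True) \<le> 2"
    unfolding mg_degree_def by (simp only: card.empty)
  with special_component(3)[OF self_in_component_of[OF zero_vert]] show False
    by simp
qed

text \<open>The terminal vertex of a path of length 3 is at odd distance from its initial vertex, hence adjacent to it.\<close>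

lemma special_closed: "\<exists>m<4. q m = (q i + q l + (n - q j)) mod n"
proof -
  \<comment> \<open>The path of length 3 runs from \<open>(0, True)\<close> to
    \<open>(q i, False)\<close>, then along increment \<open>q j\<close> backwards to subscript
    \<open>k\<close>, then along increment \<open>q l\<close> to \<open>k + q l\<close>.\<close>
  define k where "k = q i + (n - q j)"
  have kj: "(k + q j) mod n = q i"
    using q_less[of j] q_less[of i] by (simp add: k_def)
  have 0: "(0, True) \<in> verts C"
    by (rule self_in_component_of[OF zero_vert])
  then have "(q i, False) \<in> verts C"
    using target_in_component[of 0 i] q_less[of i] by simp
  then have "((k + q l) mod n, False) \<in> verts C"
    using target_in_component[of k j] target_in_component[of k l] kj by simp
  then obtain es where "mg_walk C (0, True) es ((k + q l) mod n, False)" "length es \<le> 2"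
    by (rule diameter_walk[OF special_component(1) 0])
  then have es: "mg_walk (star_graph P) (0, True) es ((k + q l) mod n, False)" "length es \<le> 2"
    by (simp_all add: walk_component_of)
  \<comment> \<open>Signs alternate along a walk, which excludes length 2 between vertices of
    opposite sign.\<close>
  have flip: "b' \<noteq> b" if e: "e \<in> edges (star_graph P)" "ends (star_graph P) e = {(x, b), (y, b')}" for e x y b b'
  proof -
    obtain k j where "e = edge k j"
      by (rule edgeE[OF e(1)])
    then have "{(k mod n, True), ((k + q j) mod n, False)} = {(x, b), (y, b')}"
      using e(2) by (simp only: ends_edge)
    then show ?thesis
      by (auto simp: doubleton_eq_iff)
  qed
  consider "es = []" | e where "es = [e]" | e e' where "es = [e, e']"
    using es(2) by (cases es rule: remdups_adj.cases) auto
  then obtain e where "es = [e]"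
  proof cases
    case (3 e e')
    with es(1) obtain y b where yb: "e \<in> edges (star_graph P)" "ends (star_graph P) e = {(0, True), (y, b)}"
      "e' \<in> edges (star_graph P)" "ends (star_graph P) e' = {(y, b), ((k + q l) mod n, False)}"
      by auto
    show ?thesis
      using flip[OF yb(1,2)] flip[OF yb(3,4)] by simp
  qed (use es in auto)
  then have "mg_walk (star_graph P) (0, True) [e] ((k + q l) mod n, False)"
    using es(1) by (simp only:)
  then have e: "e \<in> edges (star_graph P)"
    "ends (star_graph P) e = {(0, True), ((k + q l) mod n, False)}"
    unfolding mg_walk.simps by blast+
  obtain k' m where m: "k' < n" "m < 4" "e = edge k' m"
    using edgeE[OF e(1)] .
  have "{(k' mod n, True), ((k' + q m) mod n, False)} = {(0, True), ((k + q l) mod n, False)}"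
    using e(2) unfolding m(3) ends_edge .
  then have "k' = 0" "(k' + q m) mod n = (k + q l) mod n"
    using m(1) by (auto simp: doubleton_eq_iff)
  then have "q m = (k + q l) mod n"
    using q_less[of m] by simp
  then show ?thesis
    using m(2) by (auto simp: k_def ac_simps)
qed

lemma special_imp_odd:
  assumes irr: "irreducible_cyclic n (square 0 0)"
  shows "n = 8" "j < 4 \<Longrightarrow> odd (q j)"
proof -
  define S where "S = q ` {..<4}"
  have lt4: "{..<4} = {0, 1, 2, 3 :: nat}"
    by auto
  have card: "card S = 4"
    unfolding S_def using card_image[OF special_inj] by simp
  have S: "S \<subseteq> {..<n}"
    using q_less by (auto simp: S_def)
  have "\<Sum>S = q 0 + q 1 + q 2 + q 3"
    unfolding S_def sum.reindex[OF special_inj] by (simp add: lt4)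
  with q_sum have sum: "n dvd \<Sum>S"
    by (simp add: dvd_eq_mod_eq_0)
  have closed: "(a + b + (n - c)) mod n \<in> S" if abc: "a \<in> S" "b \<in> S" "c \<in> S" for a b c
  proof -
    obtain i l j where "a = q i" "b = q l" "c = q j"
      using abc by (auto simp: S_def)
    with special_closed[of i l j] show ?thesis
      unfolding S_def by (metis imageI lessThan_iff)
  qed
  note coset = zero_sum_coset[OF S n_pos closed sum, unfolded card]
  have q8: "n dvd 8 * q j" if "j < 4" for j
    using coset(1)[of "q j"] that by (simp add: S_def)
  have letters: "fst ` set (square 0 0) = {0, q 0, (q 0 + q 1) mod n, (q 0 + q 1 + q 2) mod n}"
    using q_less[of 0] by (auto simp: square_def positive_word_def numeral_2_eq_2)
  have "n dvd 8 * x" if "x \<in> insert n (fst ` set (square 0 0))" for x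
  proof -
    have mod: "n dvd 8 * (y mod n)" if "n dvd 8 * y" for y
      using that by (metis dvd_eq_mod_eq_0 mod_mult_right_eq)
    have sums: "n dvd 8 * q 0" "n dvd 8 * (q 0 + q 1)" "n dvd 8 * (q 0 + q 1 + q 2)"
      using q8[of 0] q8[of 1] q8[of 2] by (simp_all add: distrib_left)
    note 8 = sums(1) mod[OF sums(2)] mod[OF sums(3)] dvd_triv_right[of n 8] dvd_0_right[of n]
    have "x = n \<or> x = 0 \<or> x = q 0 \<or> x = (q 0 + q 1) mod n \<or> x = (q 0 + q 1 + q 2) mod n"
      using that unfolding letters by blast
    then show ?thesis
      using 8 by (metis mult_0_right)
  qed
  \<comment> \<open>By irreducibility the greatest common divisor of these multiples of 8 is 8
    itself.\<close>
  then have "n dvd Gcd ((*) 8 ` insert n (fst ` set (square 0 0)))"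
    by (intro Gcd_greatest) auto
  then have "n dvd 8"
    using irr by (simp add: irreducible_cyclic_def Gcd_mult del: image_insert)
  moreover have "4 \<le> n"
    using card_mono[OF _ S] card by simp
  moreover have "n \<noteq> 4"
  proof
    assume "n = 4"
    \<comment> \<open>The sum would be 0 + 1 + 2 + 3 = 6, which 4 does not divide.\<close>
    then have "S = {..<4}"
      using S card by (intro card_subset_eq) auto
    with sum \<open>n = 4\<close> show False
      by (simp add: lt4)
  qed
  moreover have "n \<le> 8"
    using \<open>n dvd 8\<close> by (rule dvd_imp_le) simp
  ultimately show n8: "n = 8"
  proof -
    assume n: "n dvd 8" "4 \<le> n" "n \<noteq> 4" "n \<le> 8"
    then have "n = 5 \<or> n = 6 \<or> n = 7 \<or> n = 8"
      by linarith
    with n(1) show "n = 8"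
      by auto
  qed
  assume j: "j < 4"
  \<comment> \<open>As 8 divides four times each difference of increments, all increments have the
    same parity. If they were even, then \<open>n\<close> and all subscripts would be even, against
    irreducibility.\<close>
  have "even (q j) \<longleftrightarrow> even (q i)" if "i < 4" for i
  proof -
    have "8 dvd 4 * (q i + (8 - q j))"
      using coset(2)[of "q i" "q j"] that j by (simp add: S_def n8)
    then have "even (q i + (8 - q j))"
      by presburger
    with q_less[of j] n8 show ?thesis by auto
  qed
  then have par: "even (q 0)" "even (q 1)" "even (q 2)" if "even (q j)"
    using that by auto
  show "odd (q j)"
  proof
    assume "even (q j)"
    have n: "even n"
      using n8 by (simp only:) simp
    have sums: "even (q 0)" "even (q 0 + q 1)" "even (q 0 + q 1 + q 2)"
      using par[OF \<open>even (q j)\<close>] by simp_all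
    have "2 dvd x" if x: "x \<in> insert n (fst ` set (square 0 0))" for x
    proof -
      have "x = n \<or> x = 0 \<or> x = q 0 \<or> x = (q 0 + q 1) mod n \<or> x = (q 0 + q 1 + q 2) mod n"
        using x unfolding letters by blast
      then show ?thesis
        using n sums(1) dvd_mod[OF sums(2) n] dvd_mod[OF sums(3) n] by (metis dvd_0_right)
    qed
    then have "2 dvd Gcd (insert n (fst ` set (square 0 0)))"
      by (rule Gcd_greatest)
    with irr show False
      by (simp add: irreducible_cyclic_def)
  qed
qed

end

end

section \<open>Sufficiency: the star graph for \<open>n = 8\<close> and four distinct odd
  increments\<close>

context cyclic_square
begin

context
  assumes n8: "n = 8" and odd_q: "\<And>j. j < 4 \<Longrightarrow> odd (q j)" and inj: "inj_on q {..<4}"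
begin

lemma verts8: "verts (star_graph P) = {..<8} \<times> UNIV"
  unfolding verts_star unfolding n8 ..

lemma ends8: "ends (star_graph P) (edge k j) = {(k mod 8, True), ((k + q j) mod 8, False)}"
  unfolding ends_edge unfolding n8 ..

lemma q_less8: "q j < 8"
  using q_less[of j] n8 by linarith

text \<open>There are only four odd residues modulo 8, and the increments are four distinct
  ones.\<close>

lemma residue_attained:
  assumes "odd r" "r < 8"
  obtains j where "j < 4" "q j = r"
proof -
  have odds: "x \<in> {1, 3, 5, 7}" if "odd x" "x < 8" for x :: nat
    using that by (auto elim!: less_8_cases)
  have "q ` {..<4} = {1, 3, 5, 7}"
    using odd_q q_less8 card_image[OF inj] by (intro card_subset_eq image_subsetI odds) auto
  with odds[OF assms] that show thesis
    by (metis imageE lessThan_iff)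
qed

definition part :: "nat \<Rightarrow> bool \<Rightarrow> nat letter set" where
  "part c b = {k. k < 8 \<and> k mod 2 = c} \<times> {b}"

lemma part_cards: "c < 2 \<Longrightarrow> finite (part c b) \<and> card (part c b) = 4"
proof -
  have "{k. k < 8 \<and> k mod 2 = 0} = {0, 2, 4, 6 :: nat}" "{k. k < 8 \<and> k mod 2 = 1} = {1, 3, 5, 7 :: nat}"
    by (auto elim: less_8_cases)
  note residues = this
  assume "c < 2"
  then have "c = 0 \<or> c = 1"
    by linarith
  then have "finite {k. k < 8 \<and> k mod 2 = c} \<and> card {k. k < 8 \<and> k mod 2 = c} = 4"
    by (elim disjE) (simp_all only: residues, simp_all)
  then show ?thesis
    unfolding part_def card_cartesian_product by simp
qed

text \<open>The edges join \<open>x\<^sub>k\<close> to \<open>x\<^bsub>k+r\<^esub>\<^sup>-\<^sup>1\<close> for all odd \<open>r\<close>, so the components are distinguished by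
  the parity of the subscript of their positive letters.\<close>

definition letter_class :: "nat letter \<Rightarrow> nat" where
  "letter_class v = (if snd v then fst v else fst v + 1) mod 2"

lemma letter_class_less [simp]: "letter_class v < 2"
  by (simp add: letter_class_def)

lemma part_union:
  "c < 2 \<Longrightarrow> part c True \<union> part (1 - c) False = {v \<in> verts (star_graph P). letter_class v = c}"
  by (auto simp: part_def verts8 letter_class_def less_2_cases_iff mod_Suc split: if_splits)

text \<open>An odd increment switches the parity of the subscript; the summand 1 for negative
  letters compensates for this.\<close>

lemma edge_class:
  assumes "e \<in> edges (star_graph P)" "ends (star_graph P) e = {u, v}"
  shows "letter_class u = letter_class v"
proof -
  obtain k j where j: "j < 4" "e = edge k j"
    using edgeE[OF assms(1)] .
  then have "{u, v} = {(k mod 8, True), ((k + q j) mod 8, False)}"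
    using assms(2) by (simp only: ends8)
  moreover have "letter_class (k mod 8, True) = letter_class ((k + q j) mod 8, False)"
  proof -
    have "(k mod 8) mod 2 = ((k + q j) mod 8 + 1) mod 2"
    proof -
      have cancel: "x mod 8 mod 2 = x mod 2" for x :: nat
        by (simp add: mod_mod_cancel)
      have "((k + q j) mod 8 + 1) mod 2 = ((k + q j) mod 8 mod 2 + 1) mod 2"
        by (simp only: mod_add_left_eq)
      also have "\<dots> = (k + (q j + 1)) mod 2"
        by (simp only: cancel mod_add_left_eq add.assoc)
      also have "\<dots> = k mod 2"
        using odd_q[OF j(1)] by (elim oddE) simp
      finally show ?thesis
        by (simp only: cancel)
    qed
    then show ?thesis
      by (simp only: letter_class_def fst_conv snd_conv if_True if_False)
  qed
  ultimately show ?thesis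
    by (auto simp: doubleton_eq_iff)
qed

lemma edge_between:
  assumes "c < 2" "a \<in> part c True" "b \<in> part (1 - c) False"
  obtains k j where "j < 4" "ends (star_graph P) (edge k j) = {a, b}"
proof -
  obtain k l where kl: "a = (k, True)" "b = (l, False)" "k < 8" "l < 8" "k mod 2 \<noteq> l mod 2"
    using assms by (auto simp: part_def less_2_cases_iff)
  \<comment> \<open>\<open>r\<close> is \<open>l - k\<close> modulo 8, odd because \<open>k\<close>
    and \<open>l\<close> have different parities.\<close>
  define r where "r = (l + (8 - k)) mod 8"
  have "odd r"
    using kl(3,5) by (simp add: r_def dvd_mod_iff mod2_eq_if split: if_splits)
  then obtain j where j: "j < 4" "q j = r"
    using residue_attained[of r] by (auto simp: r_def)
  have "(k + r) mod 8 = l"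
    using kl(3,4) by (simp add: r_def mod_simps)
  with j kl show thesis
    using that[of j k] by (simp add: ends8)
qed

lemma class_walk: "mg_walk (star_graph P) u es v \<Longrightarrow> letter_class u = letter_class v"
proof (induction es arbitrary: u)
  case (Cons e es)
  then obtain w where "e \<in> edges (star_graph P)" "ends (star_graph P) e = {u, w}"
    "mg_walk (star_graph P) w es v"
    unfolding mg_walk.simps by blast
  then show ?case
    using Cons.IH[of w] edge_class[of e u w] by (simp only:)
qed simp

text \<open>No edge leaves a class. Within a class all positive vertices are adjacent to all
  negative ones, so everything is reached through one vertex of each sign.\<close>

lemma component_verts:
  assumes "u \<in> verts (star_graph P)"
  shows "verts (mg_component_of (star_graph P) u) = {v \<in> verts (star_graph P). letter_class v = letter_class u}"
    (is "verts ?C = ?V")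
proof
  show "verts ?C \<subseteq> ?V"
  proof
    fix v assume "v \<in> verts ?C"
    then obtain es where "mg_walk (star_graph P) u es v"
      unfolding verts_component_of by blast
    from mg_walk_verts[OF this] class_walk[OF this] show "v \<in> ?V"
      by simp
  qed
next
  define c where "c = letter_class u"
  have c: "c < 2"
    by (simp add: c_def)
  have c': "1 - c < 2"
    by linarith
  have V: "?V = part c True \<union> part (1 - c) False"
    unfolding c_def by (rule part_union[symmetric]) simp
  have pv: "part c True \<subseteq> verts (star_graph P)" "part (1 - c) False \<subseteq> verts (star_graph P)"
    using V by blast+
  have step1: "b \<in> verts ?C" if ab: "a \<in> part c True" "b \<in> part (1 - c) False" "a \<in> verts ?C" for a b
  proof -
    obtain k j where "ends (star_graph P) (edge k j) = {a, b}"
      using edge_between[OF c ab(1,2)] .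
    with ab pv show ?thesis
      by (intro component_of_step[OF ab(3) edge_in]) auto
  qed
  have step2: "a \<in> verts ?C" if ab: "a \<in> part c True" "b \<in> part (1 - c) False" "b \<in> verts ?C" for a b
  proof -
    obtain k j where "ends (star_graph P) (edge k j) = {a, b}"
      using edge_between[OF c ab(1,2)] .
    with ab pv show ?thesis
      by (intro component_of_step[OF ab(3) edge_in]) (auto simp: insert_commute)
  qed
  have "part c True \<noteq> {}" "part (1 - c) False \<noteq> {}"
    using part_cards[OF c, of True] part_cards[OF c', of False] by auto
  then obtain a0 b0 where 0: "a0 \<in> part c True" "b0 \<in> part (1 - c) False"
    by blast
  have u: "u \<in> verts ?C"
    by (rule self_in_component_of[OF assms])
  have "u \<in> part c True \<union> part (1 - c) False"
    unfolding V[symmetric] using assms by simp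
  then have ab: "a0 \<in> verts ?C" "b0 \<in> verts ?C"
    using step1 step2 0 u by blast+
  show "?V \<subseteq> verts ?C"
    unfolding V using step1[OF 0(1) _ ab(1)] step2[OF _ 0(2) ab(2)] by blast
qed

text \<open>Edges with equal ends coincide, since the difference of the subscripts determines the
  increment and, by injectivity of \<open>q\<close>, the index \<open>j\<close>.\<close>

lemma component_cb:
  assumes "u \<in> verts (star_graph P)"
  defines "c \<equiv> letter_class u"
  shows "complete_bipartite (mg_component_of (star_graph P) u) (part c True) (part (1 - c) False)"
proof -
  let ?C = "mg_component_of (star_graph P) u"
  have c: "c < 2"
    by (simp add: c_def)
  have V: "verts ?C = part c True \<union> part (1 - c) False"
    unfolding part_union[OF c] unfolding c_def by (rule component_verts[OF assms(1)])
  have edgeC: "\<exists>k j. k < 8 \<and> j < 4 \<and> e = edge k j \<and> ends ?C e = {(k, True), ((k + q j) mod 8, False)}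
      \<and> ends ?C e \<subseteq> verts ?C" if "e \<in> edges ?C" for e
  proof -
    have e: "e \<in> edges (star_graph P)" "ends ?C e \<subseteq> verts ?C"
      using that by (simp_all add: edges_component_of)
    obtain k j where kj: "k < n" "j < 4" "e = edge k j"
      using edgeE[OF e(1)] .
    then have k: "k < 8"
      using n8 by linarith
    with kj(3) have "ends ?C e = {(k, True), ((k + q j) mod 8, False)}"
      by (simp only: ends_component_of ends8) simp
    with k kj e(2) show ?thesis
      by blast
  qed
  have "inj_on (ends ?C) (edges ?C)"
  proof (rule inj_onI)
    fix e e' assume e: "e \<in> edges ?C" "e' \<in> edges ?C" "ends ?C e = ends ?C e'"
    obtain k j where kj: "k < 8" "j < 4" "e = edge k j" "ends ?C e = {(k, True), ((k + q j) mod 8, False)}"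
      using edgeC[OF e(1)] by blast
    obtain k' j' where kj': "k' < 8" "j' < 4" "e' = edge k' j'" "ends ?C e' = {(k', True), ((k' + q j') mod 8, False)}"
      using edgeC[OF e(2)] by blast
    have eq: "k = k'" "(k + q j) mod 8 = (k + q j') mod 8"
      using e(3) unfolding kj(4) kj'(4) by (auto simp: doubleton_eq_iff)
    then have "q j = q j'"
      using cong_add_lcancel_nat[of k "q j" "q j'" 8] q_less8[of j] q_less8[of j'] by (simp add: cong_def)
    then have "j = j'"
      using inj kj(2) kj'(2) by (auto dest: inj_onD)
    with eq kj kj' show "e = e'"
      by simp
  qed
  moreover have "ends ?C ` edges ?C = {{a, b} | a b. a \<in> part c True \<and> b \<in> part (1 - c) False}"
  proof (intro equalityI subsetI)
    fix E assume "E \<in> ends ?C ` edges ?C"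
    then obtain e where e: "e \<in> edges ?C" "E = ends ?C e"
      by blast
    then obtain k j where "ends ?C e = {(k, True), ((k + q j) mod 8, False)}" "ends ?C e \<subseteq> verts ?C"
      using edgeC[OF e(1)] by blast
    then have "E = {(k, True), ((k + q j) mod 8, False)}" "(k, True) \<in> part c True"
      "((k + q j) mod 8, False) \<in> part (1 - c) False"
      using e(2) V by (auto simp: part_def)
    then show "E \<in> {{a, b} | a b. a \<in> part c True \<and> b \<in> part (1 - c) False}"
      by blast
  next
    fix E assume "E \<in> {{a, b} | a b. a \<in> part c True \<and> b \<in> part (1 - c) False}"
    then obtain a b where ab: "a \<in> part c True" "b \<in> part (1 - c) False" "E = {a, b}"
      by blast
    obtain k j where kj: "ends (star_graph P) (edge k j) = {a, b}"
      using edge_between[OF c ab(1,2)] .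
    then have "edge k j \<in> edges ?C"
      unfolding edges_component_of using edge_in ab V by simp
    with kj ab(3) show "E \<in> ends ?C ` edges ?C"
      by (metis ends_component_of imageI)
  qed
  ultimately show ?thesis
    unfolding complete_bipartite_def using V by (auto simp: part_def)
qed

lemma card_components: "card (mg_components (star_graph P)) = 2"
proof -
  have v: "(0, True) \<in> verts (star_graph P)" "(1, True) \<in> verts (star_graph P)"
    by (simp_all add: verts8)
  \<comment> \<open>A component depends on its base vertex only through its vertex set.\<close>
  have eq: "mg_component_of (star_graph P) u = mg_component_of (star_graph P) v"
    if "u \<in> verts (star_graph P)" "v \<in> verts (star_graph P)" "letter_class u = letter_class v" for u v
    using component_verts[OF that(1)] component_verts[OF that(2)] that(3)
    unfolding mg_component_of_def Let_def by simp
  have cls: "letter_class (0, True) = 0" "letter_class (1, True) = 1"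
    by (simp_all add: letter_class_def)
  have "mg_components (star_graph P) =
      {mg_component_of (star_graph P) (0, True), mg_component_of (star_graph P) (1, True)}"
  proof (intro equalityI subsetI)
    fix C assume "C \<in> mg_components (star_graph P)"
    then obtain u where u: "u \<in> verts (star_graph P)" "C = mg_component_of (star_graph P) u"
      by (auto simp: mg_components_def)
    have "letter_class u = 0 \<or> letter_class u = 1"
      using letter_class_less[of u] by linarith
    then show "C \<in> {mg_component_of (star_graph P) (0, True), mg_component_of (star_graph P) (1, True)}"
      using eq[OF u(1) v(1)] eq[OF u(1) v(2)] u(2) cls by auto
  qed (use v in \<open>auto simp: mg_components_def\<close>)
  moreover have "mg_component_of (star_graph P) (0, True) \<noteq> mg_component_of (star_graph P) (1, True)"
  proof
    assume "mg_component_of (star_graph P) (0, True) = mg_component_of (star_graph P) (1, True)"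
    then have "(0, True) \<in> verts (mg_component_of (star_graph P) (1, True))"
      using self_in_component_of[OF v(1)] by (simp only:)
    then show False
      unfolding component_verts[OF v(2)] using cls by (simp del: One_nat_def)
  qed
  ultimately show ?thesis
    by simp
qed

lemma cyclically_reduced_square: "cyclically_reduced_word (square k j)"
  by (simp add: cyclically_reduced_word_def square_def reduced_positive_word)
    (simp add: positive_word_def inv_letter_def)

lemma special_if_odd: "special_presentation 2 4 2 P"
  unfolding special_presentation_def
proof (intro conjI ballI card_components)
  show "finite_cyclically_reduced_presentation P"
    unfolding finite_cyclically_reduced_presentation_def rels_P
    using cyclically_reduced_square n_pos by (auto simp: square_def positive_word_def)
  show "length r = 4" if "r \<in> rels P" for r
    using that rels_P by auto
  show "mg_isomorphic \<Gamma> \<Delta>"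
    if comp: "\<Gamma> \<in> mg_components (star_graph P)" "\<Delta> \<in> mg_components (star_graph P)" for \<Gamma> \<Delta>
  proof -
    obtain u v where uv: "u \<in> verts (star_graph P)" "\<Gamma> = mg_component_of (star_graph P) u"
      "v \<in> verts (star_graph P)" "\<Delta> = mg_component_of (star_graph P) v"
      using comp unfolding mg_components_def by blast
    have "\<exists>f. bij_betw f (part c b) (part d b)" if "c < 2" "d < 2" for c d b
      using part_cards[OF that(1), of b] part_cards[OF that(2), of b] by (simp add: finite_same_card_bij)
    moreover have "1 - letter_class x < 2" for x
      by linarith
    ultimately obtain f h where "bij_betw f (part (letter_class u) True) (part (letter_class v) True)"
      "bij_betw h (part (1 - letter_class u) False) (part (1 - letter_class v) False)"
      by (meson letter_class_less)
    then show ?thesis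
      unfolding uv(2,4) by (rule cb_isomorphic[OF component_cb[OF uv(1)] component_cb[OF uv(3)]])
  qed
  fix \<Gamma> assume "\<Gamma> \<in> mg_components (star_graph P)"
  then obtain u where u: "u \<in> verts (star_graph P)" "\<Gamma> = mg_component_of (star_graph P) u"
    by (auto simp: mg_components_def)
  define c where "c = letter_class u"
  note cb = component_cb[OF u(1), folded u(2) c_def]
  have A: "finite (part c True)" "card (part c True) = 4"
    and B: "finite (part (1 - c) False)" "card (part (1 - c) False) = 4"
    using part_cards[of c True] part_cards[of "1 - c" False] by (simp_all add: c_def)
  have two: "\<exists>x y. x \<in> S \<and> y \<in> S \<and> x \<noteq> y" if "card S = 4" for S :: "nat letter set"
  proof -
    have "\<not> card S \<le> Suc 0" "finite S"
      using that by (auto intro: card_ge_0_finite)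
    then show ?thesis
      using card_le_Suc0_iff_eq by blast
  qed
  obtain a a' where a: "a \<in> part c True" "a' \<in> part c True" "a \<noteq> a'"
    using two[OF A(2)] by blast
  obtain b b' where b: "b \<in> part (1 - c) False" "b' \<in> part (1 - c) False" "b \<noteq> b'"
    using two[OF B(2)] by blast
  show "mg_connected \<Gamma>"
    using cb_connected[OF cb] a b by blast
  show "mg_bipartite \<Gamma>"
    by (rule cb_bipartite[OF cb])
  show "mg_diameter \<Gamma> = enat 2"
    using cb_diameter[OF cb _ a] b by blast
  show "mg_girth \<Gamma> = enat (2 * 2)"
    using cb_girth[OF cb a b] by simp
  have "edges \<Gamma> \<subseteq> edges (star_graph P)"
    unfolding u(2) edges_component_of by blast
  then have "finite (edges \<Gamma>)"
    using finite_edges_star finite_subset by blast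
  then show "3 \<le> mg_degree \<Gamma> v" if "v \<in> verts \<Gamma>" for v
    using cb_degree[OF cb A(1) B(1) _ that] A(2) B(2) by simp
qed simp_all

end

end

section \<open>The criterion for being special and its translation into congruences\<close>

context cyclic_square
begin

lemma special_iff:
  assumes "irreducible_cyclic n (square 0 0)"
  shows "special_presentation 2 4 \<nu> P \<longleftrightarrow>
    n = 8 \<and> \<nu> = 2 \<and> (\<forall>j<4. odd (q j)) \<and> inj_on q {..<4}"
proof (intro iffI conjI)
  assume sp: "special_presentation 2 4 \<nu> P"
  show n8: "n = 8" and odd: "\<forall>j<4. odd (q j)"
    using special_imp_odd[OF sp assms] by blast+
  show inj: "inj_on q {..<4}"
    by (rule special_inj[OF sp])
  have "card (mg_components (star_graph P)) = 2"
    using card_components[OF n8 _ inj] odd by blast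
  with sp show "\<nu> = 2"
    by (simp add: special_presentation_def)
next
  assume "n = 8 \<and> \<nu> = 2 \<and> (\<forall>j<4. odd (q j)) \<and> inj_on q {..<4}"
  then show "special_presentation 2 4 \<nu> P"
    using special_if_odd by blast
qed

end

text \<open>Here \<open>q4\<close> is minus the sum of the others, as 7 is -1 modulo 8.
  Multiplication by an odd \<open>q1\<close> permutes the odd residues; the six alternatives are the
  ordered pairs of distinct elements of \<open>3 q1, 5 q1, 7 q1\<close>, and \<open>q4\<close> is
  then the remaining one because 1 + 3 + 5 + 7 = 16.\<close>

lemma odd_permutation_iff:
  fixes q1 q2 q3 :: nat
  assumes "q1 < 8" "q2 < 8" "q3 < 8"
  defines "q4 \<equiv> 7 * (q1 + q2 + q3) mod 8"
  shows "odd q1 \<and> odd q2 \<and> odd q3 \<and> odd q4 \<and> distinct [q1, q2, q3, q4] \<longleftrightarrow>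
    q1 \<in> {1, 3, 5, 7} \<and>
    ((([q2 = 3 * q1] (mod 8) \<and> [q3 = 5 * q1] (mod 8)) \<or>
      ([q2 = 7 * q1] (mod 8) \<and> [q3 = 5 * q1] (mod 8))) \<or>
     (([q2 = 5 * q1] (mod 8) \<and> [q3 = 3 * q1] (mod 8)) \<or>
      ([q2 = 7 * q1] (mod 8) \<and> [q3 = 3 * q1] (mod 8))) \<or>
     (([q2 = 3 * q1] (mod 8) \<and> [q3 = 7 * q1] (mod 8)) \<or>
      ([q2 = 5 * q1] (mod 8) \<and> [q3 = 7 * q1] (mod 8))))"
proof -
  note cases_8 = less_8_cases[OF assms(2)] less_8_cases[OF assms(3)]
  consider "even q1" | "q1 = 1" | "q1 = 3" | "q1 = 5" | "q1 = 7"
    using assms(1) by (auto elim!: less_8_cases)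
  then show ?thesis
  proof cases
    case 2
    show ?thesis unfolding q4_def cong_def 2
      by (rule cases_8(1); rule cases_8(2); hypsubst; simp)
  next
    case 3
    show ?thesis unfolding q4_def cong_def 3
      by (rule cases_8(1); rule cases_8(2); hypsubst; simp)
  next
    case 4
    show ?thesis unfolding q4_def cong_def 4
      by (rule cases_8(1); rule cases_8(2); hypsubst; simp)
  next
    case 5
    show ?thesis unfolding q4_def cong_def 5
      by (rule cases_8(1); rule cases_8(2); hypsubst; simp)
  qed auto
qed

section \<open>Isomorphisms with the three groups named in the theorem\<close>

lemma isomorphic_G8_if_unit:
  assumes "[u * v = 1] (mod 8)" and "map (\<lambda>j. j mod 8) js = rotate k (map (\<lambda>i. (u * i + c) mod 8) is)"
  shows "cyclically_presented_group 8 (positive_word 8 is) \<cong>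
    cyclically_presented_group 8 (positive_word 8 js)"
  using assms by (intro cyclically_presented_group_iso) (auto simp: coprime_iff_invertible_nat)

lemma eq_mod_8_if_cong: "q < 8 \<Longrightarrow> [q = m] (mod 8) \<Longrightarrow> q = m mod 8" for q m :: nat
  by (simp add: cong_def)

text \<open>Units modulo 8 are their own inverses, so \<open>v = u\<close>, and multiplying by
  \<open>q1\<close> turns the first alternative into the subscripts 0, 1, 4, 1 directly.\<close>

lemma isomorphic_G8_0141:
  fixes q1 q2 q3 :: nat
  assumes "q1 \<in> {1, 3, 5, 7}" "q2 < 8" "q3 < 8"
    "([q2 = 3 * q1] (mod 8) \<and> [q3 = 5 * q1] (mod 8)) \<or> ([q2 = 7 * q1] (mod 8) \<and> [q3 = 5 * q1] (mod 8))"
  shows "cyclically_presented_group 8 (positive_word 8 [0, q1, q1 + q2, q1 + q2 + q3]) \<cong>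
    cyclically_presented_group 8 (positive_word 8 [0, 1, 4, 1])"
  using assms(4)
proof (elim disjE conjE)
  assume "[q2 = 3 * q1] (mod 8)" "[q3 = 5 * q1] (mod 8)"
  from eq_mod_8_if_cong[OF assms(2) this(1)] eq_mod_8_if_cong[OF assms(3) this(2)] assms(1) show ?thesis
    by (intro isomorphic_G8_if_unit[where u = q1 and v = q1 and k = 0 and c = 0]) (auto simp: cong_def)
next
  assume "[q2 = 7 * q1] (mod 8)" "[q3 = 5 * q1] (mod 8)"
  from eq_mod_8_if_cong[OF assms(2) this(1)] eq_mod_8_if_cong[OF assms(3) this(2)] assms(1) show ?thesis
    \<comment> \<open>The subscripts \<open>0, q1, 0, 5 q1\<close>, multiplied by \<open>-q1\<close>
      and increased by 1, become 1, 0, 1, 4; one rotation finishes.\<close>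
    by (intro isomorphic_G8_if_unit[where u = "7 * q1" and v = "7 * q1" and k = 1 and c = 1]) (auto simp: cong_def)
qed

lemma isomorphic_G8_0161:
  fixes q1 q2 q3 :: nat
  assumes "q1 \<in> {1, 3, 5, 7}" "q2 < 8" "q3 < 8"
    "([q2 = 5 * q1] (mod 8) \<and> [q3 = 3 * q1] (mod 8)) \<or> ([q2 = 7 * q1] (mod 8) \<and> [q3 = 3 * q1] (mod 8))"
  shows "cyclically_presented_group 8 (positive_word 8 [0, q1, q1 + q2, q1 + q2 + q3]) \<cong>
    cyclically_presented_group 8 (positive_word 8 [0, 1, 6, 1])"
  using assms(4)
proof (elim disjE conjE)
  assume "[q2 = 5 * q1] (mod 8)" "[q3 = 3 * q1] (mod 8)"
  from eq_mod_8_if_cong[OF assms(2) this(1)] eq_mod_8_if_cong[OF assms(3) this(2)] assms(1) show ?thesis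
    by (intro isomorphic_G8_if_unit[where u = q1 and v = q1 and k = 0 and c = 0]) (auto simp: cong_def)
next
  assume "[q2 = 7 * q1] (mod 8)" "[q3 = 3 * q1] (mod 8)"
  from eq_mod_8_if_cong[OF assms(2) this(1)] eq_mod_8_if_cong[OF assms(3) this(2)] assms(1) show ?thesis
    by (intro isomorphic_G8_if_unit[where u = "7 * q1" and v = "7 * q1" and k = 1 and c = 1]) (auto simp: cong_def)
qed

lemma isomorphic_G8_0143:
  fixes q1 q2 q3 :: nat
  assumes "q1 \<in> {1, 3, 5, 7}" "q2 < 8" "q3 < 8"
    "([q2 = 3 * q1] (mod 8) \<and> [q3 = 7 * q1] (mod 8)) \<or> ([q2 = 5 * q1] (mod 8) \<and> [q3 = 7 * q1] (mod 8))"
  shows "cyclically_presented_group 8 (positive_word 8 [0, q1, q1 + q2, q1 + q2 + q3]) \<cong>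
    cyclically_presented_group 8 (positive_word 8 [0, 1, 4, 3])"
  using assms(4)
proof (elim disjE conjE)
  assume "[q2 = 3 * q1] (mod 8)" "[q3 = 7 * q1] (mod 8)"
  from eq_mod_8_if_cong[OF assms(2) this(1)] eq_mod_8_if_cong[OF assms(3) this(2)] assms(1) show ?thesis
    by (intro isomorphic_G8_if_unit[where u = q1 and v = q1 and k = 0 and c = 0]) (auto simp: cong_def)
next
  assume "[q2 = 5 * q1] (mod 8)" "[q3 = 7 * q1] (mod 8)"
  from eq_mod_8_if_cong[OF assms(2) this(1)] eq_mod_8_if_cong[OF assms(3) this(2)] assms(1) show ?thesis
    \<comment> \<open>The subscripts \<open>0, q1, 6 q1, 5 q1\<close>, multiplied by
      \<open>3 q1\<close> and increased by 1, become 1, 4, 3, 0; three rotations give 0, 1, 4,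
      3.\<close>
    by (intro isomorphic_G8_if_unit[where u = "3 * q1" and v = "3 * q1" and k = "Suc (Suc (Suc 0))" and c = 1])
      (auto simp: cong_def)
qed

theorem corollary6p1:
  fixes n \<nu> q1 q2 q3 :: nat
    and w :: "nat word"
    and P :: "nat presentation"
    and G :: "nat word set monoid"
  assumes "n \<ge> 1" and "\<nu> \<ge> 1"
    and "q1 < n" and "q2 < n" and "q3 < n"
    and "w = positive_word n [0, q1, q1 + q2, q1 + q2 + q3]"
    and "P = cyclic_presentation n w"
    and "irreducible_cyclic n w"
    and "non_redundant P"
    and "G = presented_group P"
  shows
    "(special_presentation 2 4 \<nu> P \<longleftrightarrow>
        n = 8 \<and> \<nu> = 2 \<and> q1 \<in> {1, 3, 5, 7} \<and>
        ((([q2 = 3 * q1] (mod n) \<and> [q3 = 5 * q1] (mod n)) \<or>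
          ([q2 = 7 * q1] (mod n) \<and> [q3 = 5 * q1] (mod n))) \<or>
         (([q2 = 5 * q1] (mod n) \<and> [q3 = 3 * q1] (mod n)) \<or>
          ([q2 = 7 * q1] (mod n) \<and> [q3 = 3 * q1] (mod n))) \<or>
         (([q2 = 3 * q1] (mod n) \<and> [q3 = 7 * q1] (mod n)) \<or>
          ([q2 = 5 * q1] (mod n) \<and> [q3 = 7 * q1] (mod n))))) \<and>
     (n = 8 \<and> \<nu> = 2 \<and> q1 \<in> {1, 3, 5, 7} \<and>
        (([q2 = 3 * q1] (mod n) \<and> [q3 = 5 * q1] (mod n)) \<or>
         ([q2 = 7 * q1] (mod n) \<and> [q3 = 5 * q1] (mod n))) \<longrightarrow>
        G \<cong> cyclically_presented_group 8 (positive_word 8 [0, 1, 4, 1]) \<and>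
        contains_copy_of (cyclically_presented_group 8 (positive_word 8 [0, 1, 4, 1]))
          (free_group {..<2::nat} \<times>\<times> free_group {..<2::nat})) \<and>
     (n = 8 \<and> \<nu> = 2 \<and> q1 \<in> {1, 3, 5, 7} \<and>
        (([q2 = 5 * q1] (mod n) \<and> [q3 = 3 * q1] (mod n)) \<or>
         ([q2 = 7 * q1] (mod n) \<and> [q3 = 3 * q1] (mod n))) \<longrightarrow>
        G \<cong> cyclically_presented_group 8 (positive_word 8 [0, 1, 6, 1])) \<and>
     (n = 8 \<and> \<nu> = 2 \<and> q1 \<in> {1, 3, 5, 7} \<and>
        (([q2 = 3 * q1] (mod n) \<and> [q3 = 7 * q1] (mod n)) \<or>
         ([q2 = 5 * q1] (mod n) \<and> [q3 = 7 * q1] (mod n))) \<longrightarrow>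
        G \<cong> cyclically_presented_group 8 (positive_word 8 [0, 1, 4, 3]))"
proof -
  \<comment> \<open>The fourth entry is minus the sum of the others modulo \<open>n\<close>, which
    closes the cyclic word; \<open>j mod 4\<close> makes the sequence periodic.\<close>
  define q where "q j = [q1, q2, q3, (n - 1) * (q1 + q2 + q3) mod n] ! (j mod 4)" for j
  have q [simp]: "q 0 = q1" "q (Suc 0) = q2" "q 2 = q3" "q (Suc (Suc 0)) = q3"
    "q 3 = (n - 1) * (q1 + q2 + q3) mod n"
    by (simp_all add: q_def)
  interpret cyclic_square n q
  proof
    show "n > 0"
      using assms(1) by simp
    show "q j < n" for j
    proof -
      have "j mod 4 \<in> {0, 1, 2, 3}"
        by auto
      then show ?thesis
        using assms(1,3-5) unfolding q_def by (elim insertE emptyE) simp_all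
    qed
    show "q (j + 4) = q j" for j
      by (simp add: q_def)
    have "q1 + q2 + q3 + (n - 1) * (q1 + q2 + q3) = n * (q1 + q2 + q3)"
      using assms(1) by (cases n) simp_all
    then show "(q 0 + q 1 + q 2 + q 3) mod n = 0"
      by (simp add: mod_add_right_eq)
  qed
  have w: "w = square 0 0"
    by (simp add: assms(6) square_def)
  have lt4: "{..<4} = set [0, 1, 2, 3 :: nat]"
    by auto
  have odd: "(\<forall>j<4. odd (q j)) \<longleftrightarrow> odd q1 \<and> odd q2 \<and> odd q3 \<and> odd ((n - 1) * (q1 + q2 + q3) mod n)"
  proof -
    have "(\<forall>j<4. odd (q j)) \<longleftrightarrow> (\<forall>j\<in>{..<4}. odd (q j))"
      by blast
    also have "\<dots> \<longleftrightarrow> odd (q 0) \<and> odd (q 1) \<and> odd (q 2) \<and> odd (q 3)"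
      unfolding lt4 by (simp only: list.set ball_simps simp_thms)
    finally show ?thesis
      by (simp only: q One_nat_def)
  qed
  have inj: "inj_on q {..<4} \<longleftrightarrow> distinct [q1, q2, q3, (n - 1) * (q1 + q2 + q3) mod n]"
  proof -
    have "inj_on q {..<4} \<longleftrightarrow> distinct (map q [0, 1, 2, 3])"
      unfolding lt4 distinct_map by simp
    then show ?thesis
      by (simp only: list.map q One_nat_def)
  qed
  have special: "special_presentation 2 4 \<nu> P \<longleftrightarrow> n = 8 \<and> \<nu> = 2 \<and>
      odd q1 \<and> odd q2 \<and> odd q3 \<and> odd ((n - 1) * (q1 + q2 + q3) mod n) \<and>
      distinct [q1, q2, q3, (n - 1) * (q1 + q2 + q3) mod n]"
    unfolding assms(7) w special_iff[OF assms(8)[unfolded w]] odd inj by blast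
  have G: "G = cyclically_presented_group n (positive_word n [0, q1, q1 + q2, q1 + q2 + q3])"
    by (simp add: assms(6,7,10) cyclically_presented_group_def)
  show ?thesis
  proof (cases "n = 8")
    case True
    have lt: "q1 < 8" "q2 < 8" "q3 < 8"
      using assms(3-5) True by simp_all
    have seven: "8 - 1 = (7 :: nat)"
      by simp
    have "special_presentation 2 4 \<nu> P \<longleftrightarrow> \<nu> = 2 \<and>
        (odd q1 \<and> odd q2 \<and> odd q3 \<and> odd (7 * (q1 + q2 + q3) mod 8) \<and>
         distinct [q1, q2, q3, 7 * (q1 + q2 + q3) mod 8])"
      unfolding special unfolding True seven by blast
    note sp = this[unfolded odd_permutation_iff[OF lt]]
    show ?thesis
      unfolding sp unfolding G True
      using isomorphic_G8_0141[OF _ lt(2,3)] isomorphic_G8_0161[OF _ lt(2,3)] isomorphic_G8_0143[OF _ lt(2,3)] G8_0141_contains_free_square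
      by blast
  next
    case False
    then show ?thesis
      unfolding special by blast
  qed
qed

end
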